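(* Let $p(\cdot),q(\cdot)\in \mathcal{P}(\mathbb{R})$ be such that $$\lim_{|x| \to +\infty} p(x) = 1 \qquad \text{and} \qquad \lim_{|x| \to +\infty} q(x) = +\infty.$$ Then $\mathscr{F}: L^{p(\cdot)}(\mathbb{R})\to L^{q(\cdot)}(\mathbb{R})$ is bounded if and only if $1\in L^{p'(\cdot)}(\mathbb{R})\cap L^{q(\cdot)}(\mathbb{R})$, where $1$ denotes the constant function.
   Context: $\mathcal{P}(\mathbb{R})$ is the set of Lebesgue measurable functions (exponents) $p(\cdot):\mathbb{R}\to[1,+\infty]$. The conjugate exponent $p'(\cdot)$ is defined pointwise by $\frac1{p(x)}+\frac1{p'(x)}=1$, with $1/\infty=0$. With $\Omega_\infty:=\{x: p(x)=+\infty\}$, the modular is $\rho_{p(\cdot)}(f):=\int_{\mathbb{R}\setminus\Omega_\infty}|f(x)|^{p(x)}dx+\|f\|_{L^\infty(\Omega_\infty)}$. $L^{p(\cdot)}(\mathbb{R})$ is the Banach space of measurable (complex-valued) functions $f$ with $\rho_{p(\cdot)}(f/\lambda)<\infty$ for some $\lambda>0$, with the Luxemburg norm $\|f\|_{L^{p(\cdot)}(\mathbb{R})}=\inf\{\lambda>0:\rho_{p(\cdot)}(f/\lambda)\le1\}$. The Fourier transform is $\mathscr{F}f=\hat f$, where $\hat f(\xi)=\int_{\mathbb{R}}f(x)e^{-2\pi i x\xi}dx$ for Schwartz $f$, extended to tempered distributions by $\langle\hat g,f\rangle=\langle g,\hat f\rangle$ for Schwartz $f$; every element of $L^{p(\cdot)}(\mathbb{R})$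 defines a tempered distribution. "$\mathscr{F}:L^{p(\cdot)}(\mathbb{R})\to L^{q(\cdot)}(\mathbb{R})$ is bounded" means that there is $C>0$ such that for every $f\in L^{p(\cdot)}(\mathbb{R})$ the distribution $\hat f$ is (represented by) a function in $L^{q(\cdot)}(\mathbb{R})$ and $\|\hat f\|_{L^{q(\cdot)}(\mathbb{R})}\le C\|f\|_{L^{p(\cdot)}(\mathbb{R})}$. *)

theory Defs
  imports "HOL-Analysis.Analysis" "HOL-Probability.Essential_Supremum"
begin

section \<open>Variable exponent Lebesgue spaces on the real line\<close>

definition exponents :: "(real \<Rightarrow> ennreal) set" where
  "exponents = {p. p \<in> borel_measurable lebesgue \<and> (\<forall>x. 1 \<le> p x)}"

text \<open>The equation \<open>1/p(x) + 1/p'(x) = 1\<close> solved for \<open>p'(x)\<close>; on \<^typ>\<open>ennreal\<close>,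
  \<open>inverse \<infinity> = 0\<close> and \<open>inverse 0 = \<infinity>\<close>. See \<open>conj_exponent\<close> below.\<close>

definition conj_exp :: "(real \<Rightarrow> ennreal) \<Rightarrow> real \<Rightarrow> ennreal" where
  "conj_exp p x = inverse (1 - inverse (p x))"

lemma conj_exponent:
  assumes "1 \<le> p x"
  shows "inverse (p x) + inverse (conj_exp p x) = 1"
proof -
  have "inverse (p x) \<le> 1"
    using assms by (cases "p x") (auto simp: inverse_ennreal divide_simps simp flip: ennreal_1)
  moreover have "inverse (inverse y) = y" for y :: ennreal
    by (cases y; cases "y = 0") (auto simp: inverse_ennreal less_top)
  ultimately show ?thesis
    by (simp add: conj_exp_def)
qed

definition inf_set :: "(real \<Rightarrow> ennreal) \<Rightarrow> real set" where
  "inf_set p = {x. p x = \<infinity>}"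

definition modular :: "(real \<Rightarrow> ennreal) \<Rightarrow> (real \<Rightarrow> complex) \<Rightarrow> ennreal" where
  "modular p f =
     (\<integral>\<^sup>+ x \<in> - inf_set p. ennreal (norm (f x) powr enn2real (p x)) \<partial>lebesgue)
     + esssup (restrict_space lebesgue (inf_set p)) (\<lambda>x. ennreal (norm (f x)))"

definition Lp_space :: "(real \<Rightarrow> ennreal) \<Rightarrow> (real \<Rightarrow> complex) set" where
  "Lp_space p = {f. f \<in> borel_measurable lebesgue \<and>
     (\<exists>l::real. l > 0 \<and> modular p (\<lambda>x. f x / of_real l) < \<infinity>)}"

definition Lp_norm :: "(real \<Rightarrow> ennreal) \<Rightarrow> (real \<Rightarrow> complex) \<Rightarrow> real" where
  "Lp_norm p f = Inf {l::real. l > 0 \<and> modular p (\<lambda>x. f x / of_real l) \<le> 1}"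

section \<open>Schwartz functions and the Fourier transform of distributions\<close>

definition iter_deriv :: "nat \<Rightarrow> (real \<Rightarrow> complex) \<Rightarrow> real \<Rightarrow> complex" where
  "iter_deriv n = ((\<lambda>f x. vector_derivative f (at x)) ^^ n)"

definition schwartz :: "(real \<Rightarrow> complex) set" where
  "schwartz = {\<phi>. (\<forall>n x. iter_deriv n \<phi> differentiable (at x)) \<and>
     (\<forall>m n. bounded (range (\<lambda>x. x ^ m *\<^sub>R iter_deriv n \<phi> x)))}"

definition fourier :: "(real \<Rightarrow> complex) \<Rightarrow> real \<Rightarrow> complex" where
  "fourier \<phi> \<xi> = (LINT x|lebesgue. \<phi> x * exp (- 2 * of_real pi * \<i> * of_real x * of_real \<xi>))"

text \<open>A distribution is given by a functional on functions of which only the values on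
  \<^const>\<open>schwartz\<close> are relevant. For \<open>f\<close> in a space \<^const>\<open>Lp_space\<close>, the integral
  below converges for every Schwartz function.\<close>

definition distr_of :: "(real \<Rightarrow> complex) \<Rightarrow> (real \<Rightarrow> complex) \<Rightarrow> complex" where
  "distr_of f \<phi> = (LINT x|lebesgue. f x * \<phi> x)"

definition fourier_distr :: "((real \<Rightarrow> complex) \<Rightarrow> complex) \<Rightarrow> (real \<Rightarrow> complex) \<Rightarrow> complex" where
  "fourier_distr T \<phi> = T (fourier \<phi>)"

definition represents :: "(real \<Rightarrow> complex) \<Rightarrow> ((real \<Rightarrow> complex) \<Rightarrow> complex) \<Rightarrow> bool" where
  "represents g T \<longleftrightarrow> (\<forall>\<phi>\<in>schwartz. T \<phi> = distr_of g \<phi>)"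

definition fourier_bounded :: "(real \<Rightarrow> ennreal) \<Rightarrow> (real \<Rightarrow> ennreal) \<Rightarrow> bool" where
  "fourier_bounded p q \<longleftrightarrow>
     (\<exists>C::real. C > 0 \<and> (\<forall>f \<in> Lp_space p. \<exists>g \<in> Lp_space q.
        represents g (fourier_distr (distr_of f)) \<and> Lp_norm q g \<le> C * Lp_norm p f))"

end

theory Submission
  imports Defs "HOL-Probability.Probability"
begin

text \<open>
  If \<open>1 \<in> L\<^sup>p\<^sup>' \<inter> L\<^sup>q\<close>, then Young's inequality gives \<open>L\<^sup>p \<subseteq> L\<^sup>1\<close>, monotonicity of the modular gives
  \<open>L\<^sup>\<infinity> \<subseteq> L\<^sup>q\<close>, and the Fourier transform maps \<open>L\<^sup>1\<close> to \<open>L\<^sup>\<infinity>\<close>.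

  Conversely, the normalised indicator of \<open>[y, y + e]\<close> has a Fourier transform of modulus at
  least \<open>1/2\<close> on \<open>\<bar>\<xi>\<bar> \<le> 1/(16 e)\<close>, whatever \<open>y\<close> is. Far out, where \<open>p\<close> is close to \<open>1\<close>, its
  \<open>L\<^sup>p\<close> norm is at most \<open>2\<close>, so boundedness controls the modular of a constant in \<open>L\<^sup>q\<close> on longer
  and longer intervals. For \<open>p'\<close>, the same indicators, placed where \<open>q\<close> is large, are tested
  against the transform of \<open>\<mu> powr (1 - p')\<close> (with the phase that cancels the one of the
  transformed indicator); as \<open>(p' - 1) p = p'\<close>, its modular is the integral of
  \<open>\<mu> powr (- p')\<close>, which therefore cannot exceed \<open>1\<close> for large \<open>\<mu>\<close>.
\<close>

section \<open>Modulars and Luxemburg norms\<close>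

lemma inf_set_measurable:
  assumes "p \<in> exponents"
  shows "inf_set p \<in> sets lebesgue"
proof -
  have [measurable]: "p \<in> borel_measurable lebesgue"
    using assms by (simp add: exponents_def)
  have "{x \<in> space lebesgue. p x = \<infinity>} \<in> sets lebesgue" by measurable
  then show ?thesis by (simp add: inf_set_def)
qed

lemma exponents_measurable: "p \<in> exponents \<Longrightarrow> p \<in> borel_measurable lebesgue"
  by (simp add: exponents_def)

lemma enn2real_exponent_ge_1:
  assumes "p \<in> exponents" "p x \<noteq> \<infinity>"
  shows "1 \<le> enn2real (p x)"
proof -
  have "1 \<le> p x" using assms by (simp add: exponents_def)
  with assms(2) show ?thesis
    by (cases "p x") (auto simp flip: ennreal_1)
qed

lemma modular_leD:
  assumes p: "p \<in> exponents" and f: "f \<in> borel_measurable lebesgue" and m: "modular p f \<le> 1"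
  shows "(\<integral>\<^sup>+ x \<in> - inf_set p. ennreal (norm (f x) powr enn2real (p x)) \<partial>lebesgue) \<le> 1"
    and "AE x in lebesgue. p x = \<infinity> \<longrightarrow> norm (f x) \<le> 1"
proof -
  have le: "esssup (restrict_space lebesgue (inf_set p)) (\<lambda>x. ennreal (norm (f x))) \<le> 1"
    using m unfolding modular_def by (meson add_increasing zero_le order_trans order_refl)
  show "(\<integral>\<^sup>+ x \<in> - inf_set p. ennreal (norm (f x) powr enn2real (p x)) \<partial>lebesgue) \<le> 1"
    using m unfolding modular_def by (meson add_increasing2 zero_le order_trans order_refl)
  have "AE x in restrict_space lebesgue (inf_set p). ennreal (norm (f x)) \<le> 1"
    using esssup_AE[of "\<lambda>x. ennreal (norm (f x))" "restrict_space lebesgue (inf_set p)"]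
    by eventually_elim (rule order_trans[OF _ le])
  then have "AE x in lebesgue. x \<in> inf_set p \<longrightarrow> ennreal (norm (f x)) \<le> 1"
    using inf_set_measurable[OF p] by (subst (asm) AE_restrict_space_iff) auto
  then show "AE x in lebesgue. p x = \<infinity> \<longrightarrow> norm (f x) \<le> 1"
    by (simp add: inf_set_def)
qed

lemma modular_leI:
  assumes p: "p \<in> exponents" and f: "f \<in> borel_measurable lebesgue"
    and a: "(\<integral>\<^sup>+ x \<in> - inf_set p. ennreal (norm (f x) powr enn2real (p x)) \<partial>lebesgue) \<le> a"
    and b: "AE x in lebesgue. p x = \<infinity> \<longrightarrow> ennreal (norm (f x)) \<le> b"
  shows "modular p f \<le> a + b"
  unfolding modular_def
proof (rule add_mono[OF a])
  have [measurable]: "f \<in> borel_measurable lebesgue" by fact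
  have "AE x in restrict_space lebesgue (inf_set p). ennreal (norm (f x)) \<le> b"
    using inf_set_measurable[OF p] b
    by (subst AE_restrict_space_iff) (auto simp: inf_set_def)
  moreover have "(\<lambda>x. ennreal (norm (f x))) \<in> borel_measurable (restrict_space lebesgue (inf_set p))"
    by (rule measurable_restrict_space1) measurable
  ultimately show "esssup (restrict_space lebesgue (inf_set p)) (\<lambda>x. ennreal (norm (f x))) \<le> b"
    by (rule esssup_I[rotated])
qed

lemma modular_mono:
  assumes p: "p \<in> exponents" and f: "f \<in> borel_measurable lebesgue"
    and le: "AE x in lebesgue. norm (f x) \<le> norm (g x)"
  shows "modular p f \<le> modular p g"
proof -
  let ?N = "restrict_space lebesgue (inf_set p)"
  have *: "AE x in lebesgue. x \<in> inf_set p \<longrightarrow> ennreal (norm (g x)) \<le> esssup ?N (\<lambda>x. ennreal (norm (g x)))"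
    using esssup_AE[of "\<lambda>x. ennreal (norm (g x))" ?N] inf_set_measurable[OF p]
    by (subst (asm) AE_restrict_space_iff) auto
  have "AE x in lebesgue. p x = \<infinity> \<longrightarrow> ennreal (norm (f x)) \<le> esssup ?N (\<lambda>x. ennreal (norm (g x)))"
    using * le
  proof eventually_elim
    case (elim x)
    then show ?case
      by (auto simp: inf_set_def intro: order_trans[OF ennreal_leI])
  qed
  moreover have "(\<integral>\<^sup>+ x \<in> - inf_set p. ennreal (norm (f x) powr enn2real (p x)) \<partial>lebesgue)
     \<le> (\<integral>\<^sup>+ x \<in> - inf_set p. ennreal (norm (g x) powr enn2real (p x)) \<partial>lebesgue)"
    by (rule nn_integral_mono_AE, use le in eventually_elim)
       (auto simp: indicator_def intro!: powr_mono2)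
  ultimately have "modular p f \<le> (\<integral>\<^sup>+ x \<in> - inf_set p. ennreal (norm (g x) powr enn2real (p x)) \<partial>lebesgue)
      + esssup ?N (\<lambda>x. ennreal (norm (g x)))"
    by (intro modular_leI[OF p f])
  then show ?thesis by (simp add: modular_def)
qed

text \<open>Every exponent is at least 1, so \<open>K powr r\<close> dominates \<open>K\<close> for
  \<open>K \<ge> 1\<close>. The essential supremum scales exactly, and a finite modular can
  therefore be pushed below 1.\<close>

lemma modular_divide_le:
  assumes p: "p \<in> exponents" and f[measurable]: "f \<in> borel_measurable lebesgue" and K: "K \<ge> 1"
  shows "modular p (\<lambda>x. f x / of_real K) \<le> ennreal (1 / K) * modular p f"
proof -
  let ?N = "restrict_space lebesgue (inf_set p)"
  note [measurable] = exponents_measurable[OF p] inf_set_measurable[OF p]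
  have pw: "(a / K) powr r \<le> a powr r / K" if "a \<ge> 0" "r \<ge> 1" for a r :: real
  proof -
    have "K powr 1 \<le> K powr r" using K that by (intro powr_mono) auto
    then have "a powr r / K powr r \<le> a powr r / K" using K by (intro divide_left_mono) auto
    then show ?thesis using K that by (simp add: powr_divide)
  qed
  have *: "AE x in lebesgue. x \<in> inf_set p \<longrightarrow> ennreal (norm (f x)) \<le> esssup ?N (\<lambda>x. ennreal (norm (f x)))"
    using esssup_AE[of "\<lambda>x. ennreal (norm (f x))" ?N] inf_set_measurable[OF p]
    by (subst (asm) AE_restrict_space_iff) auto
  have "modular p (\<lambda>x. f x / of_real K) \<le>
      ennreal (1 / K) * (\<integral>\<^sup>+ x \<in> - inf_set p. ennreal (norm (f x) powr enn2real (p x)) \<partial>lebesgue)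
      + ennreal (1 / K) * esssup ?N (\<lambda>x. ennreal (norm (f x)))"
  proof (rule modular_leI[OF p])
    have "(\<integral>\<^sup>+ x \<in> - inf_set p. ennreal (norm (f x / of_real K) powr enn2real (p x)) \<partial>lebesgue)
      \<le> (\<integral>\<^sup>+ x. ennreal (1 / K) * (ennreal (norm (f x) powr enn2real (p x)) * indicator (- inf_set p) x) \<partial>lebesgue)"
      using K p enn2real_exponent_ge_1[OF p]
      by (intro nn_integral_mono)
        (auto simp: indicator_def norm_divide inf_set_def simp flip: ennreal_mult intro!: ennreal_leI pw)
    also have "\<dots> = ennreal (1 / K) * (\<integral>\<^sup>+ x \<in> - inf_set p. ennreal (norm (f x) powr enn2real (p x)) \<partial>lebesgue)"
      by (rule nn_integral_cmult) measurable
    finally show "(\<integral>\<^sup>+ x \<in> - inf_set p. ennreal (norm (f x / of_real K) powr enn2real (p x)) \<partial>lebesgue) \<le> \<dots>" .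
    show "AE x in lebesgue. p x = \<infinity> \<longrightarrow> ennreal (norm (f x / of_real K)) \<le> ennreal (1 / K) * esssup ?N (\<lambda>x. ennreal (norm (f x)))"
      using *
    proof eventually_elim
      case (elim x)
      have "ennreal (norm (f x / of_real K)) = ennreal (1 / K) * ennreal (norm (f x))"
        using K by (simp add: norm_divide flip: ennreal_mult)
      with elim show ?case by (auto simp: inf_set_def intro!: mult_left_mono)
    qed
  qed measurable
  then show ?thesis by (simp add: modular_def distrib_left)
qed

lemma modular_divide_le_1_mono:
  assumes p: "p \<in> exponents" and f: "f \<in> borel_measurable lebesgue"
    and l: "0 < l" "l \<le> m" and m: "modular p (\<lambda>x. f x / of_real l) \<le> 1"
  shows "modular p (\<lambda>x. f x / of_real m) \<le> 1"
proof -
  have [measurable]: "f \<in> borel_measurable lebesgue" by fact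
  have "modular p (\<lambda>x. f x / of_real m) \<le> modular p (\<lambda>x. f x / of_real l)"
    using l by (intro modular_mono[OF p]) (auto simp: norm_divide intro!: divide_left_mono)
  with m show ?thesis by simp
qed

lemma Lp_space_measurable: "f \<in> Lp_space p \<Longrightarrow> f \<in> borel_measurable lebesgue"
  by (simp add: Lp_space_def)

lemma Lp_spaceI:
  assumes "f \<in> borel_measurable lebesgue" "0 < l" "modular p (\<lambda>x. f x / of_real l) < \<infinity>"
  shows "f \<in> Lp_space p"
  using assms by (auto simp: Lp_space_def)

text \<open>A further division by the maximum of 1 and the finite modular \<open>M\<close> brings
  the modular down to 1. So the set whose infimum is the Luxemburg norm is never empty on
  \<open>Lp_space\<close>.\<close>

lemma Lp_spaceE:
  assumes p: "p \<in> exponents" and f: "f \<in> Lp_space p"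
  obtains l :: real where "0 < l" "modular p (\<lambda>x. f x / of_real l) \<le> 1"
proof -
  from f obtain l :: real where l: "0 < l" "modular p (\<lambda>x. f x / of_real l) < \<infinity>"
    by (auto simp: Lp_space_def)
  have [measurable]: "f \<in> borel_measurable lebesgue" by (rule Lp_space_measurable[OF f])
  define M where "M = enn2real (modular p (\<lambda>x. f x / of_real l))"
  define K where "K = max 1 M"
  have M: "modular p (\<lambda>x. f x / of_real l) = ennreal M"
    using l by (simp add: M_def)
  have "modular p (\<lambda>x. f x / of_real l / of_real K) \<le> ennreal (1 / K) * ennreal M"
    unfolding M[symmetric] by (rule modular_divide_le[OF p]) (auto simp: K_def)
  also have "\<dots> \<le> 1"
    by (simp add: K_def M_def divide_simps flip: ennreal_mult)
  finally have "modular p (\<lambda>x. f x / of_real (l * K)) \<le> 1" by simp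
  moreover have "0 < l * K" using l by (simp add: K_def)
  ultimately show ?thesis by (intro that)
qed

lemma Lp_norm_le:
  assumes "0 < l" "modular p (\<lambda>x. f x / of_real l) \<le> 1"
  shows "Lp_norm p f \<le> l"
  unfolding Lp_norm_def using assms by (intro cInf_lower bdd_belowI[of _ 0]) auto

text \<open>\<open>Inf\<close> on the reals says nothing about the empty set; membership in
  \<open>Lp_space\<close> supplies an admissible scale.\<close>

lemma Lp_norm_ge:
  assumes "p \<in> exponents" "f \<in> Lp_space p"
    and "\<And>l. 0 < l \<Longrightarrow> modular p (\<lambda>x. f x / of_real l) \<le> 1 \<Longrightarrow> c \<le> l"
  shows "c \<le> Lp_norm p f"
  unfolding Lp_norm_def
proof (rule cInf_greatest)
  show "{l::real. l > 0 \<and> modular p (\<lambda>x. f x / of_real l) \<le> 1} \<noteq> {}"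
    using assms by (auto elim: Lp_spaceE)
qed (use assms(3) in auto)

text \<open>The strict inequality yields an admissible scale below \<open>l\<close>, and
  admissibility passes to larger scales. Attainment of the infimum is never at issue.\<close>

lemma modular_divide_le_1_if_Lp_norm_less:
  assumes p: "p \<in> exponents" and f: "f \<in> Lp_space p" and l: "Lp_norm p f < l"
  shows "modular p (\<lambda>x. f x / of_real l) \<le> 1"
proof -
  obtain m where "0 < m" "modular p (\<lambda>x. f x / of_real m) \<le> 1" "m < l"
    using Lp_norm_ge[OF p f, of l] l by force
  with Lp_space_measurable[OF f] p show ?thesis
    by (intro modular_divide_le_1_mono[of p f m l]) auto
qed

section \<open>Conjugate exponents\<close>

lemma conj_exp_eq_1: "p x = \<infinity> \<Longrightarrow> conj_exp p x = 1"
  by (simp add: conj_exp_def)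

lemma conj_exp_eq_top: "p x = 1 \<Longrightarrow> conj_exp p x = \<infinity>"
  by (simp add: conj_exp_def)

text \<open>Strictly between 1 and \<infinity> both exponents are finite, so \<open>ennreal\<close>
  arithmetic can be exchanged for that of the reals; the two end values are treated separately
  throughout.\<close>

lemma conj_exp_real:
  assumes "1 < p x" "p x < \<infinity>"
  obtains r s where "1 < r" "1 < s" "1 / r + 1 / s = 1" "p x = ennreal r" "conj_exp p x = ennreal s"
proof -
  obtain r where r: "p x = ennreal r" "1 < r"
    using assms by (cases "p x") (auto simp: ennreal_less_iff simp flip: ennreal_1)
  define s where "s = r / (r - 1)"
  have "conj_exp p x = inverse (1 - ennreal (1 / r))"
    using r by (simp add: conj_exp_def inverse_ennreal divide_inverse)
  also have "1 - ennreal (1 / r) = ennreal (1 - 1 / r)"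
    using r by (metis ennreal_1 ennreal_minus divide_nonneg_nonneg less_eq_real_def zero_le_one order_trans)
  also have "inverse \<dots> = ennreal (inverse (1 - 1 / r))"
    using r by (intro inverse_ennreal) auto
  also have "inverse (1 - 1 / r) = s" using r by (simp add: s_def field_simps)
  finally have "conj_exp p x = ennreal s" .
  moreover have "1 < s" "1 / r + 1 / s = 1" using r by (auto simp: s_def field_simps)
  ultimately show ?thesis using r that by blast
qed

lemma conj_exp_cases:
  assumes "p \<in> exponents"
  obtains "p x = 1" | "p x = \<infinity>" | "1 < p x" "p x < \<infinity>"
proof -
  have "1 \<le> p x" using assms by (simp add: exponents_def)
  then show ?thesis
    using that by (metis infinity_ennreal_def less_top order_le_less)
qed

lemma conj_exp_exponents:
  assumes p: "p \<in> exponents"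
  shows "conj_exp p \<in> exponents"
proof -
  have [measurable]: "p \<in> borel_measurable lebesgue"
    by (rule exponents_measurable[OF p])
  have "1 \<le> conj_exp p x" for x
  proof (cases rule: conj_exp_cases[OF p, of x])
    case 3
    then show ?thesis
      by (elim conj_exp_real) (auto simp flip: ennreal_1)
  qed (auto simp: conj_exp_eq_1 conj_exp_eq_top)
  moreover have "conj_exp p \<in> borel_measurable lebesgue"
    unfolding conj_exp_def[abs_def] by measurable
  ultimately show ?thesis by (simp add: exponents_def)
qed

section \<open>The Fourier transform\<close>

text \<open>Function spaces here consist of Lebesgue measurable functions, whereas Fubini and
  characteristic functions are applied over \<open>lborel\<close>. A Borel representative is the
  bridge.\<close>

lemma ex_borel_AE_eq_lebesgue:
  fixes f :: "real \<Rightarrow> complex"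
  assumes "f \<in> borel_measurable lebesgue"
  obtains g where "g \<in> borel_measurable borel" "AE x in lebesgue. f x = g x"
proof -
  have [measurable]: "f \<in> borel_measurable lebesgue" by fact
  obtain a where a: "a \<in> borel_measurable lborel" "AE x in lborel. Re (f x) = a x"
    using completion_ex_borel_measurable_real[of "\<lambda>x. Re (f x)" lborel] by auto
  obtain b where b: "b \<in> borel_measurable lborel" "AE x in lborel. Im (f x) = b x"
    using completion_ex_borel_measurable_real[of "\<lambda>x. Im (f x)" lborel] by auto
  have "AE x in lebesgue. f x = Complex (a x) (b x)"
    using a(2)[THEN AE_completion] b(2)[THEN AE_completion]
    by eventually_elim (auto simp: complex_eq_iff)
  moreover have "(\<lambda>x. Complex (a x) (b x)) \<in> borel_measurable borel"
    using a(1) b(1) by (subst borel_measurable_complex_iff) auto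
  ultimately show ?thesis by (rule that[rotated])
qed

lemma fourier_cong_AE:
  assumes "f \<in> borel_measurable lebesgue" "g \<in> borel_measurable lebesgue" "AE x in lebesgue. f x = g x"
  shows "fourier f = fourier g"
proof
  fix \<xi>
  note [measurable] = assms(1,2)
  have [measurable]: "(\<lambda>x. exp (- 2 * of_real pi * \<i> * of_real x * of_real \<xi>)) \<in> borel_measurable lebesgue"
    by (intro measurable_completion) measurable
  show "fourier f \<xi> = fourier g \<xi>"
    unfolding fourier_def
    by (rule integral_cong_AE, measurable, use assms(3) in auto)
qed

lemma fourier_lborel:
  assumes [measurable]: "f \<in> borel_measurable borel"
  shows "fourier f \<xi> = (LINT x|lborel. f x * exp (- 2 * of_real pi * \<i> * of_real x * of_real \<xi>))"
  unfolding fourier_def by (rule integral_completion) measurable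

text \<open>Measurability of a parameter integral requires a jointly Borel integrand. The Borel
  representative provides one and has the same transform at every point.\<close>

lemma fourier_measurable:
  assumes f: "f \<in> borel_measurable lebesgue"
  shows "fourier f \<in> borel_measurable borel"
proof -
  obtain g where g: "g \<in> borel_measurable borel" "AE x in lebesgue. f x = g x"
    using ex_borel_AE_eq_lebesgue[OF f] .
  have [measurable]: "g \<in> borel_measurable borel" by (rule g)
  have "fourier f = fourier g"
    using g f by (intro fourier_cong_AE) (auto intro: measurable_completion)
  also have "\<dots> = (\<lambda>\<xi>. LINT x|lborel. g x * exp (- 2 * of_real pi * \<i> * of_real x * of_real \<xi>))"
    by (simp add: fourier_lborel fun_eq_iff)
  also have "\<dots> \<in> borel_measurable borel"
    by measurable
  finally show ?thesis .
qed

lemma norm_fourier_le: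
  "norm (fourier f \<xi>) \<le> (LINT x|lebesgue. norm (f x))"
  unfolding fourier_def
  by (rule order_trans[OF integral_norm_bound]) (simp add: norm_mult)

lemma integrable_fourier_mult:
  assumes f: "integrable lebesgue f" and g: "integrable lebesgue g"
  shows "integrable lebesgue (\<lambda>x. fourier f x * g x)"
proof (rule Bochner_Integration.integrable_bound)
  show "integrable lebesgue (\<lambda>x. (LINT x|lebesgue. norm (f x)) * norm (g x))"
    using g by auto
  have [measurable]: "g \<in> borel_measurable lebesgue"
    using g by auto
  have [measurable]: "fourier f \<in> borel_measurable lebesgue"
    using f by (intro measurable_completion) (simp add: fourier_measurable)
  show "(\<lambda>x. fourier f x * g x) \<in> borel_measurable lebesgue" by measurable
  show "AE x in lebesgue. norm (fourier f x * g x) \<le> norm ((LINT x|lebesgue. norm (f x)) * norm (g x))"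
    by (intro AE_I2) (auto simp: norm_mult intro!: mult_right_mono order_trans[OF norm_fourier_le])
qed

text \<open>Fubini for \<open>f x * g y\<close> times the kernel, which is symmetric in its two
  variables. The formula gives the distributional transform of integrable functions, and later moves
  the transform from one factor of a pairing to the other.\<close>

lemma fourier_multiplication_formula:
  assumes f: "integrable lebesgue f" and g: "integrable lebesgue g"
  shows "(LINT x|lebesgue. fourier f x * g x) = (LINT x|lebesgue. f x * fourier g x)"
proof -
  obtain f' where f': "f' \<in> borel_measurable borel" "AE x in lebesgue. f x = f' x"
    using ex_borel_AE_eq_lebesgue[of f] f by auto
  obtain g' where g': "g' \<in> borel_measurable borel" "AE x in lebesgue. g x = g' x"
    using ex_borel_AE_eq_lebesgue[of g] g by auto
  have [measurable]: "f' \<in> borel_measurable borel" "g' \<in> borel_measurable borel"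
    "f' \<in> borel_measurable lebesgue" "g' \<in> borel_measurable lebesgue"
    "f \<in> borel_measurable lebesgue" "g \<in> borel_measurable lebesgue"
    using f' g' f g by (auto intro: measurable_completion)
  have F: "fourier f = fourier f'" "fourier g = fourier g'"
    using f' g' by (auto intro!: fourier_cong_AE)
  have [measurable]: "fourier f' \<in> borel_measurable borel" "fourier g' \<in> borel_measurable borel"
     by (auto intro!: fourier_measurable)
  have [measurable]: "fourier f' \<in> borel_measurable lebesgue" "fourier g' \<in> borel_measurable lebesgue"
    by (auto intro!: measurable_completion)
  let ?e = "\<lambda>x \<xi>. exp (- 2 * of_real pi * \<i> * of_real x * of_real \<xi>) :: complex"
  have int: "integrable lborel f'" "integrable lborel g'"
    using integrable_cong_AE_imp[OF f, of f'] integrable_cong_AE_imp[OF g, of g'] f' g'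
    by (auto simp: integrable_completion eq_commute)
  have prod: "integrable (lborel \<Otimes>\<^sub>M lborel) (\<lambda>(x, y). f' x * g' y * ?e x y)"
  proof (rule lborel_pair.Fubini_integrable)
    have "integrable lborel (\<lambda>x. norm (f' x) * (LINT y|lborel. norm (g' y)))"
      using int by auto
    then show "integrable lborel (\<lambda>x. LINT y|lborel. norm (case (x, y) of (x, y) \<Rightarrow> f' x * g' y * ?e x y))"
      by (simp add: norm_mult)
    show "AE x in lborel. integrable lborel (\<lambda>y. case (x, y) of (x, y) \<Rightarrow> f' x * g' y * ?e x y)"
    proof (rule AE_I2)
      fix x
      show "integrable lborel (\<lambda>y. case (x, y) of (x, y) \<Rightarrow> f' x * g' y * ?e x y)"
      proof (rule Bochner_Integration.integrable_bound)
        show "integrable lborel (\<lambda>y. f' x * g' y)" using int by auto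
      qed (auto simp: norm_mult)
    qed
  qed measurable
  have "(LINT x|lebesgue. fourier f x * g x) = (LINT y|lborel. fourier f' y * g' y)"
    unfolding F by (subst integral_completion[symmetric], measurable)
      (rule integral_cong_AE, measurable, use g' in auto)
  also have "\<dots> = (LINT y|lborel. LINT x|lborel. f' x * g' y * ?e x y)"
    by (simp add: fourier_lborel mult_ac flip: integral_mult_right_zero)
  also have "\<dots> = (LINT x|lborel. LINT y|lborel. f' x * g' y * ?e x y)"
    by (rule lborel_pair.Fubini_integral[OF prod])
  also have "\<dots> = (LINT x|lborel. f' x * fourier g' x)"
    by (simp add: fourier_lborel mult_ac flip: integral_mult_right_zero)
  also have "\<dots> = (LINT x|lebesgue. f x * fourier g x)"
    unfolding F by (subst integral_completion[symmetric], measurable)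
      (rule integral_cong_AE, measurable, use f' in auto)
  finally show ?thesis .
qed


section \<open>Uniqueness of the Fourier transform of integrable functions\<close>

text \<open>The positive and negative parts of \<open>u\<close>, divided by their common mass, are
  probability densities with equal characteristic functions. Levy's uniqueness theorem makes the
  measures equal, hence the densities agree almost everywhere.\<close>

lemma char_eq_0_imp_AE_eq_0_real:
  fixes u :: "real \<Rightarrow> real"
  assumes u: "integrable lborel u"
    and 0: "\<And>t. (LINT x|lborel. of_real (u x) * iexp (t * x)) = 0"
  shows "AE x in lborel. u x = 0"
proof -
  have [measurable]: "u \<in> borel_measurable borel" using u by auto
  define v where "v = (\<lambda>x. max 0 (u x))"
  define w where "w = (\<lambda>x. max 0 (- u x))"
  define m where "m = (LINT x|lborel. v x)"
  have [measurable]: "v \<in> borel_measurable borel" "w \<in> borel_measurable borel"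
    by (auto simp: v_def w_def)
  have vw: "v x \<ge> 0" "w x \<ge> 0" "u x = v x - w x" for x by (auto simp: v_def w_def)
  have int: "integrable lborel v" "integrable lborel w"
    using u by (auto simp: v_def w_def)
  \<comment> \<open>The frequency 0 shows that both parts have the same mass, so a single
    \<open>m\<close> normalises both.\<close>
  have "(LINT x|lborel. of_real (u x)) = (0::complex)" using 0[of 0] by simp
  then have "(LINT x|lborel. u x) = 0"
    by (simp add: integral_complex_of_real)
  then have mw: "m = (LINT x|lborel. w x)"
    using int by (simp add: m_def vw(3))
  show ?thesis
  \<comment> \<open>Mass 0 does not allow normalisation, but then both parts vanish almost
    everywhere.\<close>
  proof (cases "m = 0")
    case True
    then have "AE x in lborel. v x = 0" "AE x in lborel. w x = 0"
      using vw int integral_nonneg_eq_0_iff_AE[of lborel v] integral_nonneg_eq_0_iff_AE[of lborel w]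
      by (auto simp: m_def mw[unfolded m_def])
    then show ?thesis by eventually_elim (simp add: vw)
  next
    case False
    have "m \<ge> 0" unfolding m_def using vw by (intro integral_nonneg_AE) auto
    with False have m: "m > 0" by simp
    have rd: "real_distribution (density lborel (\<lambda>x. ennreal (a x / m)))"
      if [measurable]: "a \<in> borel_measurable borel" and "\<And>x. a x \<ge> 0" "integrable lborel a"
        "(LINT x|lborel. a x) = m" for a
    proof -
      have "emeasure (density lborel (\<lambda>x. ennreal (a x / m))) UNIV = (\<integral>\<^sup>+x. ennreal (a x / m) \<partial>lborel)"
        by (simp add: emeasure_density)
      also have "\<dots> = ennreal (LINT x|lborel. a x / m)"
        using that m by (intro nn_integral_eq_integral) auto
      also have "\<dots> = 1" using that m by simp
      finally have "prob_space (density lborel (\<lambda>x. ennreal (a x / m)))"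
        by (intro prob_spaceI) simp
      then show ?thesis by (simp add: real_distribution_def real_distribution_axioms_def)
    qed
    have ch: "char (density lborel (\<lambda>x. ennreal (a x / m))) t = (LINT x|lborel. of_real (a x) * iexp (t * x)) / of_real m"
      if [measurable]: "a \<in> borel_measurable borel" and "\<And>x. a x \<ge> 0" for a t
    proof -
      have "char (density lborel (\<lambda>x. ennreal (a x / m))) t = (LINT x|lborel. (a x / m) *\<^sub>R iexp (t * x))"
        unfolding char_def using m that by (subst integral_density) auto
      also have "\<dots> = (LINT x|lborel. of_real (a x) * iexp (t * x) / of_real m)"
        by (simp add: scaleR_conv_of_real)
      finally show ?thesis by simp
    qed
    have iv: "integrable lborel (\<lambda>x. of_real (a x) * iexp (t * x))" if "integrable lborel a" for a :: "real \<Rightarrow> real" and t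
      by (rule Bochner_Integration.integrable_bound[OF that]) (use that in \<open>auto simp: norm_mult\<close>)
    have "(LINT x|lborel. of_real (v x) * iexp (t * x)) - (LINT x|lborel. of_real (w x) * iexp (t * x)) = 0" for t
      using 0[of t] int iv by (simp add: vw(3) left_diff_distrib)
    then have "char (density lborel (\<lambda>x. ennreal (v x / m))) = char (density lborel (\<lambda>x. ennreal (w x / m)))"
      using vw by (auto simp: fun_eq_iff ch)
    then have "density lborel (\<lambda>x. ennreal (v x / m)) = density lborel (\<lambda>x. ennreal (w x / m))"
      using vw int by (intro Levy_uniqueness rd) (auto simp: m_def mw[unfolded m_def])
    then have "AE x in lborel. ennreal (v x / m) = ennreal (w x / m)"
      by (intro sigma_finite_measure.density_unique[OF lborel.sigma_finite_measure_axioms]) auto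
    then show ?thesis
      by eventually_elim (use m vw in auto)
  qed
qed

text \<open>If the transform of \<open>k\<close> vanishes at all frequencies, so does that of its
  conjugate, by conjugating the integral at \<open>-t\<close>. The real and imaginary parts are
  combinations of the two, and the real case applies to each.\<close>

lemma fourier_eq_0_imp_AE_eq_0:
  fixes h :: "real \<Rightarrow> complex"
  assumes h: "integrable lebesgue h"
    and 0: "\<And>t. (LINT x|lebesgue. h x * iexp (t * x)) = 0"
  shows "AE x in lebesgue. h x = 0"
proof -
  obtain k where k: "k \<in> borel_measurable borel" "AE x in lebesgue. h x = k x"
    using ex_borel_AE_eq_lebesgue[of h] h by auto
  have [measurable]: "k \<in> borel_measurable borel" "k \<in> borel_measurable lebesgue" "h \<in> borel_measurable lebesgue"
    using k h by (auto intro: measurable_completion)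
  have int: "integrable lborel k"
    using integrable_cong_AE_imp[OF h, of k] k by (auto simp: integrable_completion eq_commute)
  have ik: "integrable lborel (\<lambda>x. k x * iexp (t * x))" for t
    by (rule Bochner_Integration.integrable_bound[OF int]) (auto simp: norm_mult)
  have [measurable]: "(\<lambda>x. iexp (t * x)) \<in> borel_measurable lebesgue" for t
    by (intro measurable_completion) measurable
  have k0: "(LINT x|lborel. k x * iexp (t * x)) = 0" for t
  proof -
    have "(LINT x|lborel. k x * iexp (t * x)) = (LINT x|lebesgue. k x * iexp (t * x))"
      by (subst integral_completion) measurable
    also have "\<dots> = (LINT x|lebesgue. h x * iexp (t * x))"
      by (rule integral_cong_AE, measurable, use k in auto)
    finally show ?thesis using 0 by simp
  qed
  have ck0: "(LINT x|lborel. cnj (k x) * iexp (t * x)) = 0" for t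
  proof -
    have "(LINT x|lborel. cnj (k x) * iexp (t * x)) = (LINT x|lborel. cnj (k x * iexp ((- t) * x)))"
      by (simp add: exp_cnj)
    also have "\<dots> = cnj (LINT x|lborel. k x * iexp ((- t) * x))"
      by (rule integral_bounded_linear[OF bounded_linear_cnj ik])
    finally show ?thesis using k0[of "-t"] by simp
  qed
  have "cnj \<in> borel_measurable borel"
    by (intro borel_measurable_continuous_onI continuous_intros)
  then have [measurable]: "(\<lambda>x. cnj (k x)) \<in> borel_measurable borel" by measurable
  have ick: "integrable lborel (\<lambda>x. cnj (k x) * iexp (t * x))" for t
    by (rule Bochner_Integration.integrable_bound[OF int]) (auto simp: norm_mult)
  have "AE x in lborel. Re (k x) = 0"
  proof (rule char_eq_0_imp_AE_eq_0_real)
    fix t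
    have "(LINT x|lborel. of_real (Re (k x)) * iexp (t * x)) =
       (LINT x|lborel. (k x * iexp (t * x) + cnj (k x) * iexp (t * x)) / 2)"
      by (intro Bochner_Integration.integral_cong) (auto simp: complex_add_cnj simp flip: distrib_right)
    also have "\<dots> = 0" using k0 ck0 ik ick by simp
    finally show "(LINT x|lborel. of_real (Re (k x)) * iexp (t * x)) = 0" .
  qed (use int in auto)
  moreover have "AE x in lborel. Im (k x) = 0"
  proof (rule char_eq_0_imp_AE_eq_0_real)
    fix t
    have "(LINT x|lborel. of_real (Im (k x)) * iexp (t * x)) =
       (LINT x|lborel. (k x * iexp (t * x) - cnj (k x) * iexp (t * x)) / (2 * \<i>))"
    proof (intro Bochner_Integration.integral_cong refl)
      fix x
      have "of_real (Im (k x)) = (k x - cnj (k x)) / (2 * \<i>)"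
        by (subst eq_divide_eq) (simp add: complex_diff_cnj mult_ac)
      then show "of_real (Im (k x)) * iexp (t * x) = (k x * iexp (t * x) - cnj (k x) * iexp (t * x)) / (2 * \<i>)"
        by (simp only: left_diff_distrib times_divide_eq_left)
    qed
    also have "\<dots> = 0" using k0 ck0 ik ick by simp
    finally show "(LINT x|lborel. of_real (Im (k x)) * iexp (t * x)) = 0" .
  qed (use int in auto)
  ultimately have "AE x in lborel. k x = 0"
    by eventually_elim (simp add: complex_eq_iff)
  then have "AE x in lebesgue. k x = 0" by (rule AE_completion)
  with k(2) show ?thesis by eventually_elim simp
qed

text \<open>Modulated Gaussians are the only Schwartz functions needed to separate functions.\<close>

definition gauss_wave :: "real \<Rightarrow> real \<Rightarrow> complex" where
  "gauss_wave t x = of_real (exp (- x\<^sup>2)) * iexp (t * x)"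

lemma norm_gauss_wave: "norm (gauss_wave t x) = exp (- x\<^sup>2)"
  by (simp add: gauss_wave_def norm_mult)

text \<open>Polynomial multiples of the wave are closed under differentiation. The linear factor is
  the derivative of the exponent once the wave is written as a single exponential; the complex
  derivative of this entire function is then restricted to the real line.\<close>

lemma gauss_wave_poly_deriv:
  "((\<lambda>x. poly P (of_real x) * gauss_wave t x) has_vector_derivative
     poly (pderiv P + P * [:\<i> * of_real t, -2:]) (of_real x) * gauss_wave t x) (at x)"
proof -
  have g: "gauss_wave t y = exp (- (of_real y)\<^sup>2 + \<i> * of_real t * of_real y)" for y
    by (simp add: gauss_wave_def mult_exp_exp algebra_simps flip: exp_of_real)
  have "((\<lambda>z. poly P z * exp (- z\<^sup>2 + \<i> * of_real t * z)) has_field_derivative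
      poly (pderiv P + P * [:\<i> * of_real t, -2:]) z * exp (- z\<^sup>2 + \<i> * of_real t * z)) (at z)" for z
    by (auto intro!: derivative_eq_intros simp: algebra_simps)
  from has_vector_derivative_real_field[OF this[of "of_real x"]]
  show ?thesis by (simp add: g)
qed

lemma iter_deriv_gauss_wave:
  "\<exists>Q. iter_deriv n (gauss_wave t) = (\<lambda>x. poly Q (of_real x) * gauss_wave t x)"
proof (induction n)
  case 0
  show ?case by (intro exI[of _ 1]) (simp add: iter_deriv_def)
next
  case (Suc n)
  then obtain Q where Q: "iter_deriv n (gauss_wave t) = (\<lambda>x. poly Q (of_real x) * gauss_wave t x)"
    by auto
  have "iter_deriv (Suc n) (gauss_wave t) = (\<lambda>x. vector_derivative (iter_deriv n (gauss_wave t)) (at x))"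
    by (simp add: iter_deriv_def)
  also have "\<dots> = (\<lambda>x. poly (pderiv Q + Q * [:\<i> * of_real t, -2:]) (of_real x) * gauss_wave t x)"
    unfolding Q by (intro ext vector_derivative_at gauss_wave_poly_deriv)
  finally show ?case by blast
qed

text \<open>A crude bound suffices: the power is at most 1 plus its square, and that square divided
  by \<open>fact k\<close> is one term of the exponential series at
  \<open>x\<^sup>2\<close>.\<close>

lemma power_abs_times_gauss_le: "\<bar>x\<bar> ^ k * exp (- x\<^sup>2) \<le> 1 + fact k" for x :: real
proof -
  have "\<bar>x\<bar> ^ k \<le> 1 + (x\<^sup>2) ^ k"
  proof (cases "\<bar>x\<bar> \<le> 1")
    case True
    then have "\<bar>x\<bar> ^ k \<le> 1" by (intro power_le_one) auto
    then show ?thesis by (rule order_trans) simp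
  next
    case False
    then have "\<bar>x\<bar> ^ k \<le> \<bar>x\<bar> ^ (2 * k)" by (intro power_increasing) auto
    then show ?thesis by (simp add: power_mult)
  qed
  moreover have "(x\<^sup>2) ^ k / fact k \<le> exp (x\<^sup>2)"
    using sum_le_suminf[OF summable_exp_generic[of "x\<^sup>2"], of "{k}"]
    by (simp add: exp_def divide_inverse_commute)
  then have "(x\<^sup>2) ^ k \<le> fact k * exp (x\<^sup>2)" by (simp add: field_simps)
  moreover have "1 \<le> exp (x\<^sup>2)" by simp
  ultimately have "\<bar>x\<bar> ^ k \<le> (1 + fact k) * exp (x\<^sup>2)" unfolding distrib_right by linarith
  then show ?thesis by (simp add: exp_minus field_simps)
qed

text \<open>Each iterated derivative is a polynomial times the wave, so every weighted derivative is
  bounded coefficient by coefficient through \<open>power_abs_times_gauss_le\<close>.\<close>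

lemma gauss_wave_schwartz: "gauss_wave t \<in> schwartz"
proof -
  have "iter_deriv n (gauss_wave t) differentiable (at x)" for n x
    using iter_deriv_gauss_wave[of n t] gauss_wave_poly_deriv
    by (metis differentiableI_vector)
  moreover have "bounded (range (\<lambda>x. x ^ m *\<^sub>R iter_deriv n (gauss_wave t) x))" for m n
  proof -
    obtain Q where Q: "iter_deriv n (gauss_wave t) = (\<lambda>x. poly Q (of_real x) * gauss_wave t x)"
      using iter_deriv_gauss_wave by blast
    have "norm (x ^ m *\<^sub>R iter_deriv n (gauss_wave t) x) \<le> (\<Sum>i\<le>degree Q. norm (coeff Q i) * (1 + fact (m + i)))" for x
    proof -
      have "norm (x ^ m *\<^sub>R iter_deriv n (gauss_wave t) x) = \<bar>x\<bar> ^ m * norm (poly Q (of_real x)) * exp (- x\<^sup>2)"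
        by (simp add: Q norm_mult norm_gauss_wave power_abs)
      also have "\<dots> \<le> \<bar>x\<bar> ^ m * (\<Sum>i\<le>degree Q. norm (coeff Q i) * \<bar>x\<bar> ^ i) * exp (- x\<^sup>2)"
        unfolding poly_altdef
        by (intro mult_right_mono mult_left_mono order_trans[OF norm_sum] sum_mono)
          (auto simp: norm_mult norm_power)
      also have "\<dots> = (\<Sum>i\<le>degree Q. norm (coeff Q i) * (\<bar>x\<bar> ^ (m + i) * exp (- x\<^sup>2)))"
        by (simp add: sum_distrib_left sum_distrib_right power_add mult_ac)
      also have "\<dots> \<le> (\<Sum>i\<le>degree Q. norm (coeff Q i) * (1 + fact (m + i)))"
        by (intro sum_mono mult_left_mono power_abs_times_gauss_le) auto
      finally show ?thesis .
    qed
    then show ?thesis by (auto simp: bounded_iff)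
  qed
  ultimately show ?thesis by (auto simp: schwartz_def)
qed

section \<open>Absolute convergence of pairings with test functions\<close>

text \<open>This is the integrable majorant for Schwartz functions. The right half-line is evaluated
  with \<open>arctan\<close>, the left one by reflection.\<close>

lemma integrable_inverse_1_plus_square: "integrable lborel (\<lambda>x::real. 1 / (1 + x\<^sup>2))"
proof -
  have *: "(\<integral>\<^sup>+ x. ennreal (1 / (1 + x\<^sup>2)) * indicator {0..} x \<partial>lborel) = ennreal (pi / 2 - arctan 0)"
    by (rule nn_integral_FTC_atLeast) (auto intro!: derivative_eq_intros tendsto_arctan_at_top simp: power2_eq_square inverse_eq_divide)
  have "(\<integral>\<^sup>+ x. ennreal (1 / (1 + x\<^sup>2)) * indicator {..0} x \<partial>lborel)
      = (\<integral>\<^sup>+ x. ennreal (1 / (1 + x\<^sup>2)) * indicator {0..} x \<partial>lborel)"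
    by (subst nn_integral_real_affine[where c = "-1" and t = 0]) (auto simp: indicator_def intro!: nn_integral_cong)
  note ** = this[unfolded *]
  have "(\<integral>\<^sup>+ x. ennreal (norm (1 / (1 + (x::real)\<^sup>2))) \<partial>lborel)
    \<le> (\<integral>\<^sup>+ x. ennreal (1 / (1 + x\<^sup>2)) * indicator {0..} x + ennreal (1 / (1 + x\<^sup>2)) * indicator {..0} x \<partial>lborel)"
    by (intro nn_integral_mono) (auto simp: indicator_def abs_if)
  also have "\<dots> = ennreal (pi / 2 - arctan 0) + ennreal (pi / 2 - arctan 0)"
    by (subst nn_integral_add) (auto simp: * ** simp del: arctan_zero_zero)
  also have "\<dots> < \<infinity>" by simp
  finally show ?thesis by (intro integrableI_bounded) auto
qed

text \<open>The seminorms with weights 1 and \<open>x\<^sup>2\<close> together bound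
  \<open>(1 + x\<^sup>2) * norm (\<phi> x)\<close>.\<close>

lemma schwartz_integrable:
  assumes "\<phi> \<in> schwartz"
  shows "integrable lebesgue \<phi>"
proof -
  have i0: "iter_deriv 0 \<phi> = \<phi>" by (simp add: iter_deriv_def)
  have "iter_deriv 0 \<phi> differentiable (at x)" for x
    using assms unfolding schwartz_def by blast
  then have "\<phi> differentiable (at x)" for x by (simp add: i0)
  then have "continuous_on UNIV \<phi>"
    by (intro continuous_at_imp_continuous_on ballI differentiable_imp_continuous_within)
  then have [measurable]: "\<phi> \<in> borel_measurable borel" by (rule borel_measurable_continuous_onI)
  have "bounded (range (\<lambda>x. x ^ m *\<^sub>R iter_deriv 0 \<phi> x))" for m
    using assms unfolding schwartz_def by blast
  then have b: "bounded (range (\<lambda>x. x ^ m *\<^sub>R \<phi> x))" for m by (simp add: i0)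
  obtain B0 where B0: "norm (\<phi> x) \<le> B0" for x using b[of 0] by (auto simp: bounded_iff)
  obtain B2 where B2: "x\<^sup>2 * norm (\<phi> x) \<le> B2" for x using b[of 2] by (auto simp: bounded_iff)
  have "integrable lborel \<phi>"
  proof (rule Bochner_Integration.integrable_bound)
    show "integrable lborel (\<lambda>x::real. (B0 + B2) * (1 / (1 + x\<^sup>2)))"
      by (intro integrable_mult_right integrable_inverse_1_plus_square)
    have le: "norm (\<phi> x) \<le> (B0 + B2) * (1 / (1 + x\<^sup>2))" for x
    proof -
      have "1 + x\<^sup>2 > 0" by (simp add: add_pos_nonneg)
      moreover have "(1 + x\<^sup>2) * norm (\<phi> x) \<le> B0 + B2"
        using B0[of x] B2[of x] by (simp add: distrib_right)
      ultimately show ?thesis by (simp add: field_simps)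
    qed
    show "AE x in lborel. norm (\<phi> x) \<le> norm ((B0 + B2) * (1 / (1 + x\<^sup>2)))"
      unfolding real_norm_def by (intro AE_I2 order_trans[OF le abs_ge_self])
  qed measurable
  then show ?thesis by (simp add: integrable_completion)
qed

text \<open>The uniqueness argument below splits the integral of a difference, so a representative
  known only to lie in \<open>Lp_space q\<close> must pair absolutely with the waves.\<close>

lemma Lp_space_times_gauss_wave_integrable:
  assumes q: "q \<in> exponents" and g: "g \<in> Lp_space q"
  shows "integrable lebesgue (\<lambda>x. g x * gauss_wave t x)"
proof -
  obtain l where l: "0 < l" "modular q (\<lambda>x. g x / of_real l) \<le> 1"
    using Lp_spaceE[OF q g] .
  note [measurable] = Lp_space_measurable[OF g] exponents_measurable[OF q] inf_set_measurable[OF q]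
  have W: "integrable lebesgue (gauss_wave t)"
    by (intro schwartz_integrable gauss_wave_schwartz)
  then have [measurable]: "gauss_wave t \<in> borel_measurable lebesgue" by auto
  have m: "(\<lambda>x. g x / of_real l) \<in> borel_measurable lebesgue" by measurable
  \<comment> \<open>Elementary substitute for Hoelder's inequality: \<open>a * e\<close> is at most
    \<open>e\<close> for small \<open>a\<close> and at most \<open>a \<le> a powr r\<close> for
    large \<open>a\<close>.\<close>
  have pw: "a * e \<le> a powr r + e" if "0 \<le> a" "0 \<le> e" "e \<le> 1" "1 \<le> r" for a e r :: real
  proof (cases "a \<le> 1")
    case True
    then have "a * e \<le> 1 * e" using that by (intro mult_right_mono) auto
    then show ?thesis by (simp add: add_increasing)
  next
    case False
    then have "a powr 1 \<le> a powr r" using that by (intro powr_mono) auto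
    moreover have "a * e \<le> a * 1" using that by (intro mult_left_mono) auto
    ultimately show ?thesis using that False unfolding powr_one[OF that(1)] by linarith
  qed
  have "(\<integral>\<^sup>+ x. ennreal (norm (g x / of_real l * gauss_wave t x)) \<partial>lebesgue)
    \<le> (\<integral>\<^sup>+ x. ennreal (norm (g x / of_real l) powr enn2real (q x)) * indicator (- inf_set q) x
          + ennreal (norm (gauss_wave t x)) \<partial>lebesgue)"
  proof (rule nn_integral_mono_AE)
    show "AE x in lebesgue. ennreal (norm (g x / of_real l * gauss_wave t x))
      \<le> ennreal (norm (g x / of_real l) powr enn2real (q x)) * indicator (- inf_set q) x
          + ennreal (norm (gauss_wave t x))"
      using modular_leD(2)[OF q m l(2)]
    proof eventually_elim
      case (elim x)
      show ?case
      proof (cases "q x = \<infinity>")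
        case True
        have "norm (g x / of_real l * gauss_wave t x) \<le> norm (gauss_wave t x)"
          using elim True unfolding norm_mult by (intro mult_left_le_one_le) auto
        then show ?thesis using True by (simp add: inf_set_def ennreal_leI)
      next
        case False
        then have "1 \<le> enn2real (q x)" by (rule enn2real_exponent_ge_1[OF q])
        then have "norm (g x / of_real l * gauss_wave t x)
            \<le> norm (g x / of_real l) powr enn2real (q x) + norm (gauss_wave t x)"
          unfolding norm_mult by (intro pw) (auto simp: norm_gauss_wave)
        from ennreal_leI[OF this] show ?thesis using False by (simp add: inf_set_def)
      qed
    qed
  qed
  also have "\<dots> = (\<integral>\<^sup>+ x \<in> - inf_set q. ennreal (norm (g x / of_real l) powr enn2real (q x)) \<partial>lebesgue)
      + (\<integral>\<^sup>+ x. ennreal (norm (gauss_wave t x)) \<partial>lebesgue)"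
    by (rule nn_integral_add) measurable
  also have "\<dots> \<le> 1 + (\<integral>\<^sup>+ x. ennreal (norm (gauss_wave t x)) \<partial>lebesgue)"
    by (intro add_right_mono modular_leD(1)[OF q m l(2)])
  also have "\<dots> < \<infinity>" using W by (simp add: integrable_iff_bounded)
  finally have "integrable lebesgue (\<lambda>x. g x / of_real l * gauss_wave t x)"
    by (intro integrableI_bounded) auto
  then have "integrable lebesgue (\<lambda>x. of_real l * (g x / of_real l * gauss_wave t x))"
    by (rule integrable_mult_right)
  then show ?thesis using l by simp
qed

lemma represents_fourier:
  assumes "integrable lebesgue f"
  shows "represents (fourier f) (fourier_distr (distr_of f))"
  unfolding represents_def fourier_distr_def distr_of_def
  using fourier_multiplication_formula[OF assms schwartz_integrable] by simp

text \<open>Boundedness only provides some representing \<open>g\<close>; this identifies it with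
  the integral \<open>fourier f\<close>, which can be estimated pointwise. Testing with all waves
  shows that \<open>g - fourier f\<close> times a Gaussian has vanishing transform, and the Gaussian
  has no zeros.\<close>

lemma represents_fourier_unique:
  assumes f: "integrable lebesgue f" and q: "q \<in> exponents" and g: "g \<in> Lp_space q"
    and rep: "represents g (fourier_distr (distr_of f))"
  shows "AE x in lebesgue. g x = fourier f x"
proof -
  have W: "integrable lebesgue (gauss_wave t)" for t
    by (intro schwartz_integrable gauss_wave_schwartz)
  have eq: "(LINT x|lebesgue. g x * gauss_wave t x) = (LINT x|lebesgue. fourier f x * gauss_wave t x)" for t
    using rep represents_fourier[OF f] gauss_wave_schwartz[of t]
    by (simp add: represents_def distr_of_def)
  have 1: "integrable lebesgue (\<lambda>x. g x * gauss_wave t x - fourier f x * gauss_wave t x)" for t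
    by (intro Bochner_Integration.integrable_diff Lp_space_times_gauss_wave_integrable[OF q g]
        integrable_fourier_mult f W)
  have wave: "gauss_wave 0 x * iexp (t * x) = gauss_wave t x" for t x
    by (simp add: gauss_wave_def)
  have "AE x in lebesgue. g x * gauss_wave 0 x - fourier f x * gauss_wave 0 x = 0"
  proof (rule fourier_eq_0_imp_AE_eq_0[OF 1])
    fix t
    have "(LINT x|lebesgue. (g x * gauss_wave 0 x - fourier f x * gauss_wave 0 x) * iexp (t * x))
       = (LINT x|lebesgue. g x * gauss_wave t x - fourier f x * gauss_wave t x)"
      by (simp only: left_diff_distrib mult.assoc wave)
    also have "\<dots> = 0"
      using eq[of t] Lp_space_times_gauss_wave_integrable[OF q g] integrable_fourier_mult[OF f W]
      by simp
    finally show "(LINT x|lebesgue. (g x * gauss_wave 0 x - fourier f x * gauss_wave 0 x) * iexp (t * x)) = 0" .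
  qed
  then show ?thesis
  proof eventually_elim
    case (elim x)
    have "gauss_wave 0 x \<noteq> 0" by (simp add: gauss_wave_def)
    with elim show ?case by (simp flip: left_diff_distrib)
  qed
qed

section \<open>Normalised indicators of intervals\<close>

definition bump :: "real \<Rightarrow> real \<Rightarrow> real \<Rightarrow> complex" where
  "bump e y x = of_real (indicator {y..y + e} x / e)"

lemma bump_measurable [measurable]: "bump e y \<in> borel_measurable borel"
  unfolding bump_def[abs_def] by measurable

lemma bump_integral:
  assumes "0 < e"
  shows "has_bochner_integral lebesgue (\<lambda>x. indicator {y..y + e} x / e :: real) 1"
proof -
  have "has_bochner_integral lebesgue (indicator {y..y + e} :: real \<Rightarrow> real) (measure lebesgue {y..y + e})"
    by (rule has_bochner_integral_real_indicator) (auto simp: emeasure_lborel_Icc_eq)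
  then have "has_bochner_integral lebesgue (\<lambda>x. indicator {y..y + e} x / e :: real) (measure lebesgue {y..y + e} / e)"
    by (rule has_bochner_integral_divide_zero)
  with assms show ?thesis by simp
qed

lemma bump_integrable:
  assumes "0 < e"
  shows "integrable lebesgue (bump e y)"
  unfolding bump_def[abs_def]
  by (intro integrable_of_real integrable.intros[OF bump_integral[OF assms]])

text \<open>On the interval the kernel differs from its value at \<open>y\<close> by at most
  \<open>2 * pi * \<bar>\<xi>\<bar> * e\<close>, which is at most \<open>8 / 16\<close> because
  \<open>pi < 4\<close>. The bump has integral 1, so its transform lies within 1/2 of a number of
  modulus 1.\<close>

lemma norm_fourier_bump_ge:
  assumes e: "0 < e" and \<xi>: "\<bar>\<xi>\<bar> * e \<le> 1 / 16"
  shows "1 / 2 \<le> norm (fourier (bump e y) \<xi>)"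
proof -
  let ?E = "\<lambda>x. exp (- 2 * of_real pi * \<i> * of_real x * of_real \<xi>) :: complex"
  have [measurable]: "?E \<in> borel_measurable lebesgue" "bump e y \<in> borel_measurable lebesgue"
    by (intro measurable_completion; measurable)+
  have b: "integrable lebesgue (bump e y)" by (rule bump_integrable[OF e])
  have b': "integrable lebesgue (\<lambda>x. bump e y x * ?E x)"
    by (rule Bochner_Integration.integrable_bound[OF b]) (measurable, simp add: norm_mult)
  have I: "(LINT x|lebesgue. bump e y x) = 1"
    using bump_integral[OF e, of y] by (simp add: bump_def has_bochner_integral_iff)
  have ker: "norm (?E x - ?E y) \<le> 1 / 2" if "y \<le> x" "x \<le> y + e" for x
  proof -
    have "?E x - ?E y = ?E y * (iexp (- 2 * pi * (x - y) * \<xi>) - 1)"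
      by (simp add: right_diff_distrib mult_exp_exp) (simp add: algebra_simps)
    then have "norm (?E x - ?E y) = norm (iexp (- 2 * pi * (x - y) * \<xi>) - 1)"
      by (simp add: norm_mult)
    also have "\<dots> \<le> \<bar>- 2 * pi * (x - y) * \<xi>\<bar>"
      using iexp_approx1[of "- 2 * pi * (x - y) * \<xi>" 0] by simp
    also have "\<dots> = 2 * pi * (\<bar>\<xi>\<bar> * (x - y))" using that by (simp add: abs_mult)
    also have "\<dots> \<le> 2 * 4 * (\<bar>\<xi>\<bar> * e)"
      using that pi_less_4 by (intro mult_mono) auto
    also have "\<dots> \<le> 1 / 2" using \<xi> by simp
    finally show ?thesis .
  qed
  have "fourier (bump e y) \<xi> - ?E y = (LINT x|lebesgue. bump e y x * (?E x - ?E y))"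
  proof -
    have "(LINT x|lebesgue. bump e y x * (?E x - ?E y)) = (LINT x|lebesgue. bump e y x * ?E x - bump e y x * ?E y)"
      by (simp only: right_diff_distrib)
    also have "\<dots> = fourier (bump e y) \<xi> - (LINT x|lebesgue. bump e y x) * ?E y"
      unfolding fourier_def using b b' by simp
    finally show ?thesis by (simp add: I)
  qed
  then have "norm (fourier (bump e y) \<xi> - ?E y) \<le> (LINT x|lebesgue. norm (bump e y x * (?E x - ?E y)))"
    by (simp only: integral_norm_bound)
  also have "\<dots> \<le> (LINT x|lebesgue. indicator {y..y + e} x / e * (1 / 2))"
  proof (rule integral_mono_AE)
    have "integrable lebesgue (\<lambda>x. bump e y x * ?E x - bump e y x * ?E y)"
      using b b' by auto
    then show "integrable lebesgue (\<lambda>x. norm (bump e y x * (?E x - ?E y)))"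
      by (intro integrable_norm) (simp only: right_diff_distrib)
    show "integrable lebesgue (\<lambda>x. indicator {y..y + e} x / e * (1 / 2) :: real)"
      by (intro integrable_mult_left integrable.intros[OF bump_integral[OF e]])
    show "AE x in lebesgue. norm (bump e y x * (?E x - ?E y)) \<le> indicator {y..y + e} x / e * (1 / 2)"
    proof (rule AE_I2)
      fix x
      show "norm (bump e y x * (?E x - ?E y)) \<le> indicator {y..y + e} x / e * (1 / 2)"
      proof (cases "x \<in> {y..y + e}")
        case True
        have "norm (bump e y x * (?E x - ?E y)) = indicator {y..y + e} x / e * norm (?E x - ?E y)"
          unfolding norm_mult using e by (simp add: bump_def norm_divide)
        also have "\<dots> \<le> indicator {y..y + e} x / e * (1 / 2)"
          using True e by (intro mult_left_mono ker) auto
        finally show ?thesis .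
      qed (simp add: bump_def)
    qed
  qed
  also have "\<dots> = 1 / 2"
    using has_bochner_integral_integral_eq[OF bump_integral[OF e, of y]]
    by (simp only: integral_mult_left_zero mult_1)
  finally have "norm (fourier (bump e y) \<xi> - ?E y) \<le> 1 / 2" .
  moreover have "norm (?E y) = 1" by simp
  ultimately show ?thesis
    using norm_triangle_sub[of "?E y" "fourier (bump e y) \<xi>"] by (simp add: norm_minus_commute)
qed

lemma nn_integral_indicator_interval:
  assumes "0 < e" "0 \<le> c"
  shows "(\<integral>\<^sup>+ x. ennreal c * indicator {y..y + e} x \<partial>lebesgue) = ennreal (c * e)"
  using assms by (subst nn_integral_cmult_indicator) (auto simp: ennreal_mult)

text \<open>The halved bump has height \<open>1 / (2 * e) > 1\<close> on an interval of length
  \<open>e\<close>. With exponents at most \<open>1 + d\<close> there, its modular is at most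
  \<open>(1 / (2 * e)) powr (1 + d) * e\<close>; the factor 2 in the scale pays for the excess
  \<open>d\<close>.\<close>

lemma ex_bump_modular_le_1:
  assumes p: "p \<in> exponents" and lim: "(p \<longlongrightarrow> 1) at_infinity" and e: "0 < e" "e < 1 / 2"
  shows "\<exists>y. modular p (\<lambda>x. bump e y x / of_real 2) \<le> 1"
proof -
  \<comment> \<open>The solution of \<open>(1 / (2 * e)) powr d = 2\<close>; it is positive because
    \<open>e < 1 / 2\<close>.\<close>
  define d where "d = ln 2 / ln (1 / (2 * e))"
  have L: "ln (1 / (2 * e)) > 0" using e by (intro ln_gt_zero) (simp add: field_simps)
  then have d: "d > 0" by (simp add: d_def)
  have d2: "(1 / (2 * e)) powr d = 2" using e L by (simp add: powr_def d_def)
  have "1 < ennreal (1 + d)" using d by (simp flip: ennreal_1 add: ennreal_less_iff del: ennreal_plus)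
  from order_tendstoD(2)[OF lim this]
  obtain b where b: "\<And>x. b \<le> norm x \<Longrightarrow> p x < ennreal (1 + d)"
    by (auto simp: eventually_at_infinity)
  define y where "y = \<bar>b\<bar>"
  have y: "p x < ennreal (1 + d)" if "y \<le> x" for x using that by (intro b) (auto simp: y_def)
  have "modular p (\<lambda>x. bump e y x / of_real 2) \<le> 1 + 0"
  proof (rule modular_leI[OF p])
    have [measurable]: "bump e y \<in> borel_measurable lebesgue" by (rule measurable_completion) measurable
    show "(\<lambda>x. bump e y x / of_real 2) \<in> borel_measurable lebesgue" by measurable
    have "(\<integral>\<^sup>+ x \<in> - inf_set p. ennreal (norm (bump e y x / of_real 2) powr enn2real (p x)) \<partial>lebesgue)
      \<le> (\<integral>\<^sup>+ x. ennreal ((1 / (2 * e)) powr (1 + d)) * indicator {y..y + e} x \<partial>lebesgue)"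
    proof (rule nn_integral_mono)
      fix x
      have "(1 / (e * 2)) powr enn2real (p x) \<le> (1 / (2 * e)) powr (1 + d)" if "y \<le> x"
      proof -
        have "enn2real (p x) \<le> 1 + d" using y[OF that] d by (cases "p x") (auto simp: ennreal_less_iff simp del: ennreal_plus)
        then show ?thesis using e by (simp add: mult.commute powr_mono)
      qed
      then show "ennreal (norm (bump e y x / of_real 2) powr enn2real (p x)) * indicator (- inf_set p) x
        \<le> ennreal ((1 / (2 * e)) powr (1 + d)) * indicator {y..y + e} x"
        using e by (auto simp: indicator_def bump_def norm_divide intro!: ennreal_leI)
    qed
    also have "\<dots> = ennreal ((1 / (2 * e)) powr (1 + d) * e)"
      using e by (intro nn_integral_indicator_interval) auto
    also have "(1 / (2 * e)) powr (1 + d) * e = 1"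
      using e by (simp add: powr_add d2)
    finally show "(\<integral>\<^sup>+ x \<in> - inf_set p. ennreal (norm (bump e y x / of_real 2) powr enn2real (p x)) \<partial>lebesgue) \<le> 1"
      by simp
    show "AE x in lebesgue. p x = \<infinity> \<longrightarrow> ennreal (norm (bump e y x / of_real 2)) \<le> 0"
      using y by (intro AE_I2) (force simp: bump_def indicator_def)
  qed
  then show ?thesis by auto
qed

text \<open>On the interval, \<open>a / e \<le> 2 / e\<close> if \<open>a \<le> 2\<close>, and \<open>a / e \<le> a powr q\<close> otherwise as soon as
  \<open>2 powr (q - 1) \<ge> 1 / e\<close>. This replaces Hoelder's inequality.\<close>

lemma ex_bump_pairing_le_3:
  assumes q: "q \<in> exponents" and lim: "(q \<longlongrightarrow> \<infinity>) at_infinity" and e: "0 < e"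
  shows "\<exists>y. \<forall>u \<in> borel_measurable lebesgue. modular q u \<le> 1 \<longrightarrow>
    (\<integral>\<^sup>+ x. ennreal (norm (u x * bump e y x)) \<partial>lebesgue) \<le> 3"
proof -
  \<comment> \<open>The second entry solves \<open>2 powr (r0 - 1) = 1 / e\<close>. The maximum with
    1 keeps \<open>r - 1\<close> nonnegative, so that \<open>a powr (r - 1)\<close> increases in
    \<open>a\<close>.\<close>
  define r0 where "r0 = max 1 (1 - log 2 e)"
  have r0: "2 powr (r0 - 1) \<ge> 1 / e"
  proof -
    have "1 / e = 2 powr (- log 2 e)" using e by (simp add: powr_minus divide_inverse)
    also have "\<dots> \<le> 2 powr (r0 - 1)" by (intro powr_mono) (auto simp: r0_def)
    finally show ?thesis .
  qed
  have "ennreal r0 < \<infinity>" by simp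
  from order_tendstoD(1)[OF lim this]
  obtain b where b: "\<And>x. b \<le> norm x \<Longrightarrow> ennreal r0 < q x"
    by (auto simp: eventually_at_infinity)
  define y where "y = \<bar>b\<bar>"
  have y: "ennreal r0 < q x" if "y \<le> x" for x using that by (intro b) (auto simp: y_def)
  have "(\<integral>\<^sup>+ x. ennreal (norm (u x * bump e y x)) \<partial>lebesgue) \<le> 3"
    if u[measurable]: "u \<in> borel_measurable lebesgue" and m: "modular q u \<le> 1" for u
  proof -
    note [measurable] = exponents_measurable[OF q] inf_set_measurable[OF q]
    have [measurable]: "{y..y + e} \<in> sets lebesgue" by simp
    have pw: "a / e \<le> 2 / e + a powr r" if "0 \<le> a" "r0 \<le> r" for a r :: real
    proof (cases "a \<le> 2")
      case True
      then have "a / e \<le> 2 / e" using e by (intro divide_right_mono) auto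
      then show ?thesis by (rule order_trans) simp
    next
      case False
      have "1 / e \<le> 2 powr (r - 1)"
        using that by (intro order_trans[OF r0] powr_mono) auto
      also have "\<dots> \<le> a powr (r - 1)"
        using False that by (intro powr_mono2) (auto simp: r0_def)
      finally have "a * (1 / e) \<le> a * a powr (r - 1)"
        using False by (intro mult_left_mono) auto
      also have "\<dots> = a powr r" using False by (simp add: powr_mult_base)
      finally show ?thesis using e by (simp add: add_increasing)
    qed
    have "(\<integral>\<^sup>+ x. ennreal (norm (u x * bump e y x)) \<partial>lebesgue)
      \<le> (\<integral>\<^sup>+ x. ennreal (2 / e) * indicator {y..y + e} x
           + ennreal (norm (u x) powr enn2real (q x)) * indicator (- inf_set q) x \<partial>lebesgue)"
    proof (rule nn_integral_mono_AE)
      show "AE x in lebesgue. ennreal (norm (u x * bump e y x)) \<le> ennreal (2 / e) * indicator {y..y + e} x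
           + ennreal (norm (u x) powr enn2real (q x)) * indicator (- inf_set q) x"
        using modular_leD(2)[OF q u m]
      proof eventually_elim
        case (elim x)
        consider "x \<notin> {y..y + e}" | "x \<in> {y..y + e}" "q x = \<infinity>" | "x \<in> {y..y + e}" "q x \<noteq> \<infinity>" by blast
        then show ?case
        proof cases
          case 2
          then have "norm (u x) / e \<le> 2 / e" using e elim by (intro divide_right_mono) auto
          with 2 e show ?thesis
            by (simp add: bump_def norm_mult norm_divide inf_set_def ennreal_leI)
        next
          case 3
          then have "r0 \<le> enn2real (q x)"
            using y[of x] by (cases "q x") (auto simp: ennreal_less_iff r0_def)
          from pw[OF _ this, of "norm (u x)"] 3 e show ?thesis
            by (simp add: bump_def norm_mult norm_divide inf_set_def ennreal_leI flip: ennreal_plus)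
        qed (simp add: bump_def)
      qed
    qed
    also have "\<dots> = (\<integral>\<^sup>+ x. ennreal (2 / e) * indicator {y..y + e} x \<partial>lebesgue)
           + (\<integral>\<^sup>+ x \<in> - inf_set q. ennreal (norm (u x) powr enn2real (q x)) \<partial>lebesgue)"
      by (rule nn_integral_add) measurable
    \<comment> \<open>The constant 3 is made of \<open>2 / e\<close> over an interval of length
      \<open>e\<close>, plus a modular of at most 1.\<close>
    also have "\<dots> = 2 + (\<integral>\<^sup>+ x \<in> - inf_set q. ennreal (norm (u x) powr enn2real (q x)) \<partial>lebesgue)"
      using e by (subst nn_integral_indicator_interval) auto
    also have "\<dots> \<le> 2 + 1"
      by (intro add_left_mono modular_leD(1)[OF q u m])
    finally show ?thesis by simp
  qed
  then show ?thesis by blast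
qed

lemma nn_integral_le_if_bounded_intervals:
  fixes F :: "real \<Rightarrow> ennreal"
  assumes [measurable]: "F \<in> borel_measurable lebesgue"
    and le: "\<And>n::nat. 0 < n \<Longrightarrow> (\<integral>\<^sup>+ x. F x * indicator {- real n..real n} x \<partial>lebesgue) \<le> c"
  shows "(\<integral>\<^sup>+ x. F x \<partial>lebesgue) \<le> c"
proof -
  have [measurable]: "{- real (Suc n)..real (Suc n)} \<in> sets lebesgue" for n by simp
  have sup: "(SUP n. F x * indicator {- real (Suc n)..real (Suc n)} x) = F x" for x
  proof (rule antisym)
    obtain n where "\<bar>x\<bar> \<le> real n" using real_arch_simple by blast
    then have "F x \<le> F x * indicator {- real (Suc n)..real (Suc n)} x" by (auto simp: indicator_def)
    then show "F x \<le> (SUP n. F x * indicator {- real (Suc n)..real (Suc n)} x)"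
      by (rule order_trans) (rule SUP_upper, simp)
  qed (auto intro!: SUP_least simp: indicator_def)
  have "(\<integral>\<^sup>+ x. F x \<partial>lebesgue) = (\<integral>\<^sup>+ x. (SUP n. F x * indicator {- real (Suc n)..real (Suc n)} x) \<partial>lebesgue)"
    by (simp only: sup)
  also have "\<dots> = (SUP n. \<integral>\<^sup>+ x. F x * indicator {- real (Suc n)..real (Suc n)} x \<partial>lebesgue)"
    by (rule nn_integral_monotone_convergence_SUP; (measurable)?)
      (auto simp: incseq_def le_fun_def intro!: mult_left_mono split: split_indicator)
  also have "\<dots> \<le> c" by (intro SUP_least le) simp
  finally show ?thesis .
qed

section \<open>Boundedness of the Fourier transform\<close>

lemma Lp_space_integrable:
  assumes p: "p \<in> exponents" and 1: "(\<lambda>x. 1) \<in> Lp_space (conj_exp p)"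
  shows "\<exists>K>0. \<forall>f \<in> Lp_space p. integrable lebesgue f \<and> (LINT x|lebesgue. norm (f x)) \<le> K * Lp_norm p f"
proof -
  let ?p' = "conj_exp p"
  have p': "?p' \<in> exponents" by (rule conj_exp_exponents[OF p])
  obtain \<mu> :: real where \<mu>: "0 < \<mu>" "modular ?p' (\<lambda>x. 1 / of_real \<mu>) \<le> 1"
    using Lp_spaceE[OF p' 1] .
  note [measurable] = exponents_measurable[OF p] inf_set_measurable[OF p]
    exponents_measurable[OF p'] inf_set_measurable[OF p']
  \<comment> \<open>One constant for three cases: \<open>c \<ge> 1\<close> serves the points with
    exponent 1, and \<open>c \<ge> \<mu>\<close> serves both Young's inequality and the points with
    exponent \<infinity>, where \<open>1 / \<mu>\<close> must dominate after scaling.\<close>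
  define c where "c = \<mu> + 1"
  have c: "1 \<le> c" "0 < c" "\<mu> \<le> c" using \<mu> by (auto simp: c_def)
  define K where "K = 2 * c"
  have K: "K > 0" using c by (simp add: K_def)
  have bound: "(\<integral>\<^sup>+ x. ennreal (norm (u x)) \<partial>lebesgue) \<le> ennreal K"
    if u[measurable]: "u \<in> borel_measurable lebesgue" and m: "modular p u \<le> 1" for u
  proof -
    let ?A = "\<lambda>x. ennreal (norm (u x) powr enn2real (p x)) * indicator (- inf_set p) x"
    let ?B = "\<lambda>x. ennreal (norm (1 / of_real \<mu> :: complex) powr enn2real (?p' x)) * indicator (- inf_set ?p') x"
    have "(\<integral>\<^sup>+ x. ennreal (norm (u x)) \<partial>lebesgue) \<le> (\<integral>\<^sup>+ x. ennreal c * (?A x + ?B x) \<partial>lebesgue)"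
    proof (rule nn_integral_mono_AE)
      show "AE x in lebesgue. ennreal (norm (u x)) \<le> ennreal c * (?A x + ?B x)"
        using modular_leD(2)[OF p u m]
      proof eventually_elim
        case (elim x)
        show ?case
        proof (cases rule: conj_exp_cases[OF p, of x])
          case 1
          have "norm (u x) \<le> c * norm (u x)"
            using mult_right_mono[OF c(1), of "norm (u x)"] by simp
          then show ?thesis using 1 c
            by (simp add: inf_set_def conj_exp_eq_top ennreal_leI flip: ennreal_mult)
        next
          case 2
          then have "norm (u x) \<le> 1" using elim by simp
          also have "1 \<le> c * (1 / \<mu>)" using \<mu> c by simp
          finally have "norm (u x) \<le> c * (1 / \<mu>)" .
          then show ?thesis using 2 \<mu> c
            by (simp add: inf_set_def conj_exp_eq_1 norm_divide ennreal_leI flip: ennreal_mult)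
        next
          case 3
          from 3 obtain r s where rs: "1 < r" "1 < s" "1 / r + 1 / s = 1" "p x = ennreal r" "?p' x = ennreal s"
            by (rule conj_exp_real)
          have "norm (u x) * (1 / \<mu>) \<le> norm (u x) powr r / r + (1 / \<mu>) powr s / s"
            using rs \<mu> by (intro Youngs_inequality) auto
          also have "\<dots> \<le> norm (u x) powr r / 1 + (1 / \<mu>) powr s / 1"
            using rs by (intro add_mono divide_left_mono) auto
          finally have "norm (u x) \<le> \<mu> * (norm (u x) powr r + (1 / \<mu>) powr s)"
            using \<mu> by (simp add: field_simps)
          also have "\<dots> \<le> c * (norm (u x) powr r + (1 / \<mu>) powr s)"
            using c by (intro mult_right_mono) auto
          finally show ?thesis using rs \<mu> c
            by (simp add: inf_set_def norm_divide ennreal_leI flip: ennreal_mult ennreal_plus)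
        qed
      qed
    qed
    also have "\<dots> = ennreal c * ((\<integral>\<^sup>+ x. ?A x \<partial>lebesgue) + (\<integral>\<^sup>+ x. ?B x \<partial>lebesgue))"
      by (subst nn_integral_cmult, measurable, subst nn_integral_add, measurable)
    also have "\<dots> \<le> ennreal c * (1 + 1)"
      using modular_leD(1)[OF p u m] modular_leD(1)[OF p' _ \<mu>(2)]
      by (intro mult_left_mono add_mono) auto
    also have "\<dots> = ennreal K" using c by (simp add: K_def ennreal_mult mult.commute)
    finally show ?thesis .
  qed
  have "integrable lebesgue f \<and> (LINT x|lebesgue. norm (f x)) \<le> K * Lp_norm p f" if f: "f \<in> Lp_space p" for f
  proof -
    have [measurable]: "f \<in> borel_measurable lebesgue" by (rule Lp_space_measurable[OF f])
    have *: "(\<integral>\<^sup>+ x. ennreal (norm (f x)) \<partial>lebesgue) \<le> ennreal (K * l)"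
      if l: "0 < l" "modular p (\<lambda>x. f x / of_real l) \<le> 1" for l
    proof -
      have "(\<integral>\<^sup>+ x. ennreal (norm (f x)) \<partial>lebesgue) = (\<integral>\<^sup>+ x. ennreal l * ennreal (norm (f x / of_real l)) \<partial>lebesgue)"
        using l by (simp add: norm_divide flip: ennreal_mult)
      also have "\<dots> = ennreal l * (\<integral>\<^sup>+ x. ennreal (norm (f x / of_real l)) \<partial>lebesgue)"
        by (rule nn_integral_cmult) measurable
      also have "\<dots> \<le> ennreal l * ennreal K"
        using l by (intro mult_left_mono bound) auto
      finally show ?thesis using K l by (simp add: mult.commute flip: ennreal_mult)
    qed
    obtain l where "0 < l" "modular p (\<lambda>x. f x / of_real l) \<le> 1"
      using Lp_spaceE[OF p f] .
    from *[OF this] have int: "integrable lebesgue f"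
      by (intro integrableI_bounded) (auto intro: le_less_trans)
    have "(LINT x|lebesgue. norm (f x)) / K \<le> Lp_norm p f"
    proof (rule Lp_norm_ge[OF p f])
      fix l :: real assume l: "0 < l" "modular p (\<lambda>x. f x / of_real l) \<le> 1"
      have "ennreal (LINT x|lebesgue. norm (f x)) = (\<integral>\<^sup>+ x. ennreal (norm (f x)) \<partial>lebesgue)"
        using int by (intro nn_integral_eq_integral[symmetric]) auto
      with *[OF l] have "ennreal (LINT x|lebesgue. norm (f x)) \<le> ennreal (K * l)" by simp
      then have "(LINT x|lebesgue. norm (f x)) \<le> K * l"
        using K l by (subst (asm) ennreal_le_iff) auto
      then show "(LINT x|lebesgue. norm (f x)) / K \<le> l" using K by (simp add: field_simps)
    qed
    with int K show ?thesis by (simp add: field_simps)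
  qed
  with K show ?thesis by blast
qed

lemma bounded_function_Lp:
  assumes q: "q \<in> exponents" and 1: "(\<lambda>x. 1) \<in> Lp_space q"
  shows "\<exists>M>0. \<forall>g B. g \<in> borel_measurable lebesgue \<longrightarrow> (\<forall>x. norm (g x) \<le> B) \<longrightarrow>
    g \<in> Lp_space q \<and> Lp_norm q g \<le> M * B"
proof -
  obtain M :: real where M: "0 < M" "modular q (\<lambda>x. 1 / of_real M) \<le> 1"
    using Lp_spaceE[OF q 1] .
  have "g \<in> Lp_space q \<and> Lp_norm q g \<le> M * B"
    if g[measurable]: "g \<in> borel_measurable lebesgue" and B: "\<And>x. norm (g x) \<le> B" for g B
  proof -
    have B0: "0 \<le> B" using B[of 0] norm_ge_zero order_trans by blast
    \<comment> \<open>Scales must be positive, but \<open>B\<close> may be 0. Hence the detour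
      through \<open>B' > B\<close>, removed afterwards by letting the excess tend to 0.\<close>
    have *: "modular q (\<lambda>x. g x / of_real (M * B')) \<le> 1" if "B < B'" for B'
    proof -
      have "modular q (\<lambda>x. g x / of_real (M * B')) \<le> modular q (\<lambda>x. 1 / of_real M)"
      proof (intro modular_mono[OF q] AE_I2)
        fix x
        have "norm (g x) / (M * B') \<le> B' / (M * B')"
          using B[of x] M B0 that by (intro divide_right_mono) auto
        then show "norm (g x / of_real (M * B')) \<le> norm (1 / of_real M :: complex)"
          using M B0 that by (simp add: norm_divide norm_mult)
      qed measurable
      with M show ?thesis by simp
    qed
    have "g \<in> Lp_space q"
      using *[of "B + 1"] M B0 by (intro Lp_spaceI[of g "M * (B + 1)"]) (auto intro: le_less_trans)
    moreover have "Lp_norm q g / M \<le> B"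
    proof (rule field_le_epsilon)
      fix e :: real assume "0 < e"
      then have "Lp_norm q g \<le> M * (B + e)"
        using M B0 by (intro Lp_norm_le *) auto
      then show "Lp_norm q g / M \<le> B + e" using M by (simp add: field_simps)
    qed
    ultimately show ?thesis using M by (simp add: field_simps)
  qed
  with M show ?thesis by blast
qed

lemma fourier_boundedI:
  assumes p: "p \<in> exponents" and q: "q \<in> exponents"
    and 1: "(\<lambda>x. 1) \<in> Lp_space (conj_exp p)" "(\<lambda>x. 1) \<in> Lp_space q"
  shows "fourier_bounded p q"
proof -
  obtain K where K: "K > 0" "\<And>f. f \<in> Lp_space p \<Longrightarrow> integrable lebesgue f"
    "\<And>f. f \<in> Lp_space p \<Longrightarrow> (LINT x|lebesgue. norm (f x)) \<le> K * Lp_norm p f"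
    using Lp_space_integrable[OF p 1(1)] by blast
  obtain M where M: "M > 0" "\<And>g B. g \<in> borel_measurable lebesgue \<Longrightarrow> (\<And>x. norm (g x) \<le> B) \<Longrightarrow>
    g \<in> Lp_space q \<and> Lp_norm q g \<le> M * B"
    using bounded_function_Lp[OF q 1(2)] by metis
  have "\<exists>g \<in> Lp_space q. represents g (fourier_distr (distr_of f)) \<and> Lp_norm q g \<le> M * K * Lp_norm p f"
    if f: "f \<in> Lp_space p" for f
  proof (rule bexI)
    have "fourier f \<in> borel_measurable lebesgue"
      using fourier_measurable[OF Lp_space_measurable[OF f]] by (intro measurable_completion) simp
    from M(2)[OF this order_trans[OF norm_fourier_le K(3)[OF f]]]
    show "fourier f \<in> Lp_space q"
      "represents (fourier f) (fourier_distr (distr_of f)) \<and> Lp_norm q (fourier f) \<le> M * K * Lp_norm p f"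
      using represents_fourier[OF K(2)[OF f]] by (auto simp: mult.assoc)
  qed
  moreover have "M * K > 0" using M K by simp
  ultimately show ?thesis unfolding fourier_bounded_def by blast
qed

section \<open>Necessity of the integrability conditions\<close>

lemma fourier_bounded_imp_const_in_target:
  assumes p: "p \<in> exponents" and q: "q \<in> exponents" and lim: "(p \<longlongrightarrow> 1) at_infinity"
    and "fourier_bounded p q"
  shows "(\<lambda>x. 1) \<in> Lp_space q"
proof -
  obtain C where C: "C > 0" "\<And>f. f \<in> Lp_space p \<Longrightarrow> \<exists>g \<in> Lp_space q.
        represents g (fourier_distr (distr_of f)) \<and> Lp_norm q g \<le> C * Lp_norm p f"
    using assms(4) by (auto simp: fourier_bounded_def)
  note [measurable] = exponents_measurable[OF q] inf_set_measurable[OF q]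
  \<comment> \<open>\<open>L\<close> is \<open>2 * (2 * C + 1)\<close>: the transformed bump has
    modulus at least 1/2 on the interval, and its norm, at most \<open>2 * C\<close>, lies strictly
    below the scale \<open>2 * C + 1\<close>.\<close>
  define L where "L = 4 * C + 2"
  have L: "L > 0" using C by (simp add: L_def)
  let ?F = "\<lambda>x. ennreal (norm (1 / of_real L :: complex) powr enn2real (q x)) * indicator (- inf_set q) x"
  have "(\<integral>\<^sup>+ x. ?F x \<partial>lebesgue) \<le> 1"
  proof (rule nn_integral_le_if_bounded_intervals)
    fix n :: nat assume n: "0 < n"
    \<comment> \<open>The largest width for which \<open>\<bar>x\<bar> * e \<le> 1 / 16\<close> on
      the whole interval of radius \<open>n\<close>.\<close>
    define e where "e = 1 / (16 * real n)"
    have e: "0 < e" "e < 1 / 2" using n by (auto simp: e_def field_simps)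
    obtain y where y: "modular p (\<lambda>x. bump e y x / of_real 2) \<le> 1"
      using ex_bump_modular_le_1[OF p lim e] by blast
    have bm: "bump e y \<in> borel_measurable lebesgue" using bump_integrable[OF e(1)] by auto
    have bp: "bump e y \<in> Lp_space p"
      using y by (intro Lp_spaceI[OF bm, of 2]) (auto intro: le_less_trans)
    obtain g where g: "g \<in> Lp_space q" "represents g (fourier_distr (distr_of (bump e y)))"
      "Lp_norm q g \<le> C * Lp_norm p (bump e y)"
      using C(2)[OF bp] by blast
    have [measurable]: "g \<in> borel_measurable lebesgue" by (rule Lp_space_measurable[OF g(1)])
    have "Lp_norm p (bump e y) \<le> 2" using y by (intro Lp_norm_le) auto
    then have "Lp_norm q g \<le> C * 2" using g(3) C(1) by (meson mult_left_mono order_less_imp_le order_trans)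
    then have m: "modular q (\<lambda>x. g x / of_real (2 * C + 1)) \<le> 1"
      by (intro modular_divide_le_1_if_Lp_norm_less[OF q g(1)]) simp
    have "(\<integral>\<^sup>+ x. ?F x * indicator {- real n..real n} x \<partial>lebesgue)
      \<le> (\<integral>\<^sup>+ x \<in> - inf_set q. ennreal (norm (g x / of_real (2 * C + 1)) powr enn2real (q x)) \<partial>lebesgue)"
    proof (rule nn_integral_mono_AE)
      show "AE x in lebesgue. ?F x * indicator {- real n..real n} x
        \<le> ennreal (norm (g x / of_real (2 * C + 1)) powr enn2real (q x)) * indicator (- inf_set q) x"
        using represents_fourier_unique[OF bump_integrable[OF e(1)] q g(1,2)]
      proof eventually_elim
        case (elim x)
        show ?case
        proof (cases "x \<in> {- real n..real n}")
          case True
          then have "\<bar>x\<bar> * e \<le> real n * e" using e by (intro mult_right_mono) auto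
          also have "\<dots> = 1 / 16" using n by (simp add: e_def)
          finally have "1 / 2 \<le> norm (g x)"
            unfolding elim by (rule norm_fourier_bump_ge[OF e(1)])
          then have "(1 / 2) / (2 * C + 1) \<le> norm (g x) / (2 * C + 1)"
            using C by (intro divide_right_mono) auto
          then have "norm (1 / of_real L :: complex) \<le> norm (g x / of_real (2 * C + 1))"
            using C L by (simp add: norm_divide L_def field_simps del: of_real_add of_real_mult)
          with True show ?thesis
            by (auto simp: indicator_def intro!: ennreal_leI powr_mono2)
        qed simp
      qed
    qed
    also have "\<dots> \<le> 1"
      by (rule modular_leD(1)[OF q _ m]) measurable
    finally show "(\<integral>\<^sup>+ x. ?F x * indicator {- real n..real n} x \<partial>lebesgue) \<le> 1" .
  qed measurable
  \<comment> \<open>The essential supremum of a constant is finite in any case, so only the integral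
    part needed work.\<close>
  then have "modular q (\<lambda>x. 1 / of_real L) \<le> 1 + ennreal (norm (1 / of_real L :: complex))"
    by (intro modular_leI[OF q]) auto
  also have "\<dots> < \<infinity>" by simp
  finally show ?thesis using L by (intro Lp_spaceI[of _ L]) auto
qed

text \<open>On this set the conjugate exponent is 1, so finite measure is what makes a constant
  integrable there.\<close>

lemma infinite_exponent_set_bounded:
  assumes lim: "(p \<longlongrightarrow> (1::ennreal)) (at_infinity :: real filter)"
  obtains b :: real where "0 \<le> b" "{x. p x = \<infinity>} \<subseteq> {-b..b}"
proof -
  obtain b where b: "\<And>x. b \<le> norm x \<Longrightarrow> p x < \<infinity>"
    using order_tendstoD(2)[OF lim, of \<infinity>] by (auto simp: eventually_at_infinity)
  have "{x. p x = \<infinity>} \<subseteq> {-\<bar>b\<bar>..\<bar>b\<bar>}"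
  proof
    fix x assume "x \<in> {x. p x = \<infinity>}"
    then have "\<not> b \<le> norm x" using b[of x] by force
    then show "x \<in> {-\<bar>b\<bar>..\<bar>b\<bar>}" by auto
  qed
  then show ?thesis by (intro that[of "\<bar>b\<bar>"]) auto
qed

lemma fourier_bounded_imp_const_in_conj:
  assumes p: "p \<in> exponents" and q: "q \<in> exponents" and lim: "(p \<longlongrightarrow> 1) at_infinity"
    and limq: "(q \<longlongrightarrow> \<infinity>) at_infinity" and "fourier_bounded p q"
  shows "(\<lambda>x. 1) \<in> Lp_space (conj_exp p)"
proof -
  obtain C where C: "C > 0" "\<And>f. f \<in> Lp_space p \<Longrightarrow> \<exists>g \<in> Lp_space q.
        represents g (fourier_distr (distr_of f)) \<and> Lp_norm q g \<le> C * Lp_norm p f"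
    using assms(5) by (auto simp: fourier_bounded_def)
  let ?p' = "conj_exp p"
  have p': "?p' \<in> exponents" by (rule conj_exp_exponents[OF p])
  note [measurable] = exponents_measurable[OF p] inf_set_measurable[OF p]
    exponents_measurable[OF p'] inf_set_measurable[OF p']
  \<comment> \<open>The duality estimate below would give
    \<open>\<mu> / 2 * A \<le> 3 * (2 * C * A)\<close>, that is
    \<open>\<mu> \<le> 12 * C\<close>.\<close>
  define \<mu> where "\<mu> = 12 * C + 1"
  have \<mu>: "\<mu> > 0" "\<mu> \<ge> 1" using C by (auto simp: \<mu>_def)
  \<comment> \<open>Off \<open>E\<close> the conjugate exponent is \<infinity>, which does not enter
    the integral, or 1, on a bounded set. The essential part of the modular is thus the integral of
    \<open>?F\<close>.\<close>
  define E where "E = {x. 1 < p x \<and> p x < \<infinity>}"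
  have "{x \<in> space lebesgue. 1 < p x \<and> p x < \<infinity>} \<in> sets lebesgue" by measurable
  then have [measurable]: "E \<in> sets lebesgue" by (simp add: E_def)
  define r where "r x = enn2real (?p' x)" for x
  have [measurable]: "r \<in> borel_measurable lebesgue" unfolding r_def[abs_def] by measurable
  have rE: "(1 - r x) * enn2real (p x) = - r x" "1 \<le> r x" if "x \<in> E" for x
  proof -
    have "1 < p x" "p x < \<infinity>" using that by (auto simp: E_def)
    then obtain a s where as: "1 < a" "1 < s" "1 / a + 1 / s = 1" "p x = ennreal a" "?p' x = ennreal s"
      by (rule conj_exp_real)
    then show "(1 - r x) * enn2real (p x) = - r x" "1 \<le> r x" by (auto simp: r_def field_simps)
  qed
  let ?F = "\<lambda>x. ennreal (\<mu> powr - r x) * indicator E x"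
  have F1: "(\<integral>\<^sup>+ x. ?F x \<partial>lebesgue) \<le> 1"
  proof (rule nn_integral_le_if_bounded_intervals)
    fix n :: nat assume n: "0 < n"
    define J where "J = {- real n..real n}"
    have [measurable]: "J \<in> sets lebesgue" by (simp add: J_def)
    have emJ: "emeasure lebesgue J = ennreal (2 * n)" using n by (simp add: J_def)
    \<comment> \<open>\<open>enn2real\<close> would turn an infinite integral into 0; finiteness
      follows next, as the integrand is at most 1 on the bounded set \<open>J\<close>.\<close>
    define A where "A = enn2real (\<integral>\<^sup>+ x. ?F x * indicator J x \<partial>lebesgue)"
    have "(\<integral>\<^sup>+ x. ?F x * indicator J x \<partial>lebesgue) \<le> (\<integral>\<^sup>+ x. indicator J x \<partial>lebesgue)"
    proof (intro nn_integral_mono)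
      fix x
      have "\<mu> powr - r x \<le> \<mu> powr 0" if "x \<in> E" using rE[OF that] \<mu> by (intro powr_mono) auto
      then show "?F x * indicator J x \<le> indicator J x"
        using \<mu> by (auto simp: indicator_def ennreal_le_1)
    qed
    also have "\<dots> = ennreal (2 * n)" by (simp add: emJ)
    finally have A: "(\<integral>\<^sup>+ x. ?F x * indicator J x \<partial>lebesgue) = ennreal A"
      unfolding A_def by (subst ennreal_enn2real) (auto intro: le_less_trans)
    have A0: "A \<ge> 0" by (simp add: A_def)
    have "A \<le> 1"
    \<comment> \<open>Assuming \<open>A > 1\<close> makes \<open>A\<close> an admissible divisor in
      \<open>modular_divide_le\<close>, so the test function \<open>f\<close>, of modular at most
      \<open>A\<close>, has norm at most \<open>A\<close>.\<close>
    proof (rule ccontr)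
      assume "\<not> A \<le> 1"
      then have A1: "1 < A" by simp
      define e where "e = 1 / (16 * real n)"
      have e: "0 < e" using n by (auto simp: e_def)
      obtain y where y: "\<And>u. u \<in> borel_measurable lebesgue \<Longrightarrow> modular q u \<le> 1 \<Longrightarrow>
          (\<integral>\<^sup>+ x. ennreal (norm (u x * bump e y x)) \<partial>lebesgue) \<le> 3"
        using ex_bump_pairing_le_3[OF q limq e] by blast
      define B where "B = fourier (bump e y)"
      have b: "integrable lebesgue (bump e y)" by (rule bump_integrable[OF e])
      have [measurable]: "bump e y \<in> borel_measurable lebesgue" using b by auto
      have [measurable]: "B \<in> borel_measurable lebesgue"
        unfolding B_def by (intro measurable_completion) (simp add: fourier_measurable)
      have B: "1 / 2 \<le> norm (B x)" if "x \<in> J" for x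
      proof -
        have "\<bar>x\<bar> * e \<le> real n * e" using e that by (intro mult_right_mono) (auto simp: J_def)
        also have "\<dots> = 1 / 16" using n by (simp add: e_def)
        finally show ?thesis unfolding B_def by (rule norm_fourier_bump_ge[OF e])
      qed
      \<comment> \<open>The extremal weight: since \<open>(1 - r) * p = - r\<close> on
        \<open>E\<close>, its \<open>p\<close>-th power is the integrand of \<open>A\<close>. It is
        bounded by 1 and supported in \<open>J\<close>, so \<open>f\<close> is integrable and its
        transform is given by the integral.\<close>
      define w where "w x = \<mu> powr (1 - r x) * indicator (E \<inter> J) x" for x
      have [measurable]: "w \<in> borel_measurable lebesgue" unfolding w_def[abs_def] by measurable
      have w: "0 \<le> w x" "w x \<le> indicator J x" for x
      proof -
        have "\<mu> powr (1 - r x) \<le> \<mu> powr 0" if "x \<in> E" using rE[OF that] \<mu> by (intro powr_mono) auto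
        then show "0 \<le> w x" "w x \<le> indicator J x" using \<mu> by (auto simp: w_def indicator_def)
      qed
      \<comment> \<open>The phase turns \<open>f x * B x\<close> into
        \<open>w x * norm (B x)\<close>. Division by zero is harmless, as \<open>B\<close> does not
        vanish on \<open>J\<close>, which contains the support of \<open>w\<close>.\<close>
      define f where "f x = of_real (w x) * (cnj (B x) / of_real (norm (B x)))" for x
      have "cnj \<in> borel_measurable borel"
        by (intro borel_measurable_continuous_onI continuous_intros)
      then have [measurable]: "(\<lambda>x. cnj (B x)) \<in> borel_measurable lebesgue" by measurable
      have fm[measurable]: "f \<in> borel_measurable lebesgue" unfolding f_def[abs_def] by measurable
      have nf: "norm (f x) = w x" for x
        using w[of x] B[of x] by (cases "x \<in> J") (auto simp: f_def norm_mult norm_divide indicator_def w_def)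
      have fB: "f x * B x = of_real (w x * norm (B x))" for x
      proof -
        have "cnj (B x) / of_real (norm (B x)) * B x = of_real (norm (B x))"
          using complex_norm_square[of "B x"]
          by (cases "B x = 0") (auto simp: field_simps power2_eq_square)
        then show ?thesis unfolding f_def mult.assoc by simp
      qed
      have int: "integrable lebesgue f"
      proof (rule Bochner_Integration.integrable_bound)
        show "integrable lebesgue (indicator J :: real \<Rightarrow> real)"
          by (rule integrable_real_indicator) (auto simp: emJ)
        show "AE x in lebesgue. norm (f x) \<le> norm (indicator J x :: real)"
          using w by (intro AE_I2) (simp add: nf)
      qed measurable
      have "modular p f \<le> ennreal A + 0"
      proof (rule modular_leI[OF p fm])
        have "(\<integral>\<^sup>+ x \<in> - inf_set p. ennreal (norm (f x) powr enn2real (p x)) \<partial>lebesgue)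
          \<le> (\<integral>\<^sup>+ x. ?F x * indicator J x \<partial>lebesgue)"
        proof (rule nn_integral_mono)
          fix x
          show "ennreal (norm (f x) powr enn2real (p x)) * indicator (- inf_set p) x \<le> ?F x * indicator J x"
            using rE(1)[of x] by (auto simp: nf w_def indicator_def powr_powr)
        qed
        then show "(\<integral>\<^sup>+ x \<in> - inf_set p. ennreal (norm (f x) powr enn2real (p x)) \<partial>lebesgue) \<le> ennreal A"
          by (simp only: A)
        show "AE x in lebesgue. p x = \<infinity> \<longrightarrow> ennreal (norm (f x)) \<le> 0"
          by (intro AE_I2) (auto simp: nf w_def E_def)
      qed
      then have mf: "modular p f \<le> ennreal A" by simp
      have "modular p (\<lambda>x. f x / of_real A) \<le> ennreal (1 / A) * ennreal A"
        using A1 mf by (intro order_trans[OF modular_divide_le[OF p fm]] mult_left_mono) auto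
      also have "\<dots> = 1" using A1 by (simp flip: ennreal_mult)
      finally have mfA: "modular p (\<lambda>x. f x / of_real A) \<le> 1" .
      have fp: "f \<in> Lp_space p"
        using A1 mfA by (intro Lp_spaceI[OF fm, of A]) (auto intro: le_less_trans)
      obtain g where g: "g \<in> Lp_space q" "represents g (fourier_distr (distr_of f))"
        "Lp_norm q g \<le> C * Lp_norm p f"
        using C(2)[OF fp] by blast
      have [measurable]: "g \<in> borel_measurable lebesgue" by (rule Lp_space_measurable[OF g(1)])
      \<comment> \<open>Twice the norm bound \<open>C * A\<close>, so that the norm of
        \<open>g\<close> is strictly below the scale.\<close>
      define N where "N = 2 * C * A"
      have N: "0 < N" using C A1 by (simp add: N_def)
      have "Lp_norm p f \<le> A" using A1 mfA by (intro Lp_norm_le) auto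
      then have "Lp_norm q g \<le> C * A" using g(3) C(1) by (meson mult_left_mono order_less_imp_le order_trans)
      also have "\<dots> < N" using C A1 by (simp add: N_def)
      finally have "modular q (\<lambda>x. g x / of_real N) \<le> 1"
        by (rule modular_divide_le_1_if_Lp_norm_less[OF q g(1)])
      then have g3: "(\<integral>\<^sup>+ x. ennreal (norm (g x / of_real N * bump e y x)) \<partial>lebesgue) \<le> 3"
        by (intro y) measurable
      define G where "G x = ?F x * indicator J x" for x
      have [measurable]: "G \<in> borel_measurable lebesgue" unfolding G_def[abs_def] by measurable
      have "ennreal (\<mu> / 2 * A) = ennreal (\<mu> / 2) * (\<integral>\<^sup>+ x. G x \<partial>lebesgue)"
        unfolding G_def A using \<mu> A0 by (intro ennreal_mult) auto
      then have c1: "ennreal (\<mu> / 2 * A) = (\<integral>\<^sup>+ x. ennreal (\<mu> / 2) * G x \<partial>lebesgue)"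
        by (subst nn_integral_cmult) measurable
      have c2: "(\<integral>\<^sup>+ x. ennreal (\<mu> / 2) * G x \<partial>lebesgue) \<le> (\<integral>\<^sup>+ x. ennreal (w x * norm (B x)) \<partial>lebesgue)"
      proof (rule nn_integral_mono)
        fix x
        have "\<mu> / 2 * \<mu> powr - r x \<le> \<mu> powr (1 - r x) * norm (B x)" if "x \<in> J"
        proof -
          have "\<mu> / 2 * \<mu> powr - r x = \<mu> powr (1 - r x) * (1 / 2)"
            using powr_mult_base[of \<mu> "- r x"] \<mu> by simp
          also have "\<dots> \<le> \<mu> powr (1 - r x) * norm (B x)"
            using B[OF that] by (intro mult_left_mono) auto
          finally show ?thesis .
        qed
        then have "ennreal (\<mu> / 2) * ennreal (\<mu> powr - r x) \<le> ennreal (\<mu> powr (1 - r x) * norm (B x))"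
          if "x \<in> J"
          using \<mu> that by (subst ennreal_mult[symmetric]) (auto intro!: ennreal_leI)
        then show "ennreal (\<mu> / 2) * G x \<le> ennreal (w x * norm (B x))"
          by (simp add: indicator_def w_def G_def)
      qed
      have "integrable lebesgue (\<lambda>x. norm (B x * f x))"
        unfolding B_def by (intro integrable_norm integrable_fourier_mult b int)
      then have "integrable lebesgue (\<lambda>x. w x * norm (B x))"
        by (simp add: norm_mult nf mult.commute)
      then have c3: "(\<integral>\<^sup>+ x. ennreal (w x * norm (B x)) \<partial>lebesgue) = ennreal (LINT x|lebesgue. w x * norm (B x))"
        by (rule nn_integral_eq_integral) (use w in auto)
      have "(LINT x|lebesgue. w x * norm (B x)) \<ge> 0"
        using w by (intro integral_nonneg_AE) auto
      then have "(LINT x|lebesgue. w x * norm (B x)) = norm (LINT x|lebesgue. f x * B x)"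
        unfolding fB integral_complex_of_real by simp
      \<comment> \<open>The transform passes from the bump to \<open>f\<close>; the bump sits where
        \<open>q\<close> is large, so the pairing is controlled by \<open>y\<close>.\<close>
      also have "(LINT x|lebesgue. f x * B x) = (LINT x|lebesgue. fourier f x * bump e y x)"
        unfolding B_def by (rule fourier_multiplication_formula[OF int b, symmetric])
      finally have c4: "(LINT x|lebesgue. w x * norm (B x)) = norm (LINT x|lebesgue. fourier f x * bump e y x)" .
      have c5: "ennreal (norm (LINT x|lebesgue. fourier f x * bump e y x))
          \<le> (\<integral>\<^sup>+ x. ennreal (norm (fourier f x * bump e y x)) \<partial>lebesgue)"
        by (intro integral_norm_bound_ennreal integrable_fourier_mult int b)
      have "(\<integral>\<^sup>+ x. ennreal (norm (fourier f x * bump e y x)) \<partial>lebesgue)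
          = (\<integral>\<^sup>+ x. ennreal N * ennreal (norm (g x / of_real N * bump e y x)) \<partial>lebesgue)"
      proof (rule nn_integral_cong_AE)
        show "AE x in lebesgue. ennreal (norm (fourier f x * bump e y x))
            = ennreal N * ennreal (norm (g x / of_real N * bump e y x))"
          using represents_fourier_unique[OF int q g(1,2)]
          by eventually_elim (use N in \<open>simp add: norm_mult norm_divide flip: ennreal_mult\<close>)
      qed
      also have "\<dots> = ennreal N * (\<integral>\<^sup>+ x. ennreal (norm (g x / of_real N * bump e y x)) \<partial>lebesgue)"
        by (rule nn_integral_cmult) measurable
      also have "\<dots> \<le> ennreal N * ennreal 3"
        using g3 by (intro mult_left_mono) auto
      also have "\<dots> = ennreal (N * 3)" using N by (intro ennreal_mult[symmetric]) auto
      finally have c6: "(\<integral>\<^sup>+ x. ennreal (norm (fourier f x * bump e y x)) \<partial>lebesgue) \<le> ennreal (N * 3)" .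
      \<comment> \<open>The factor \<open>\<mu> / 2\<close> gained here is \<open>\<mu>\<close> from
        \<open>\<mu> powr (1 - r)\<close> against \<open>\<mu> powr (- r)\<close>, times the lower
        bound 1/2 for \<open>norm (B x)\<close>.\<close>
      have "ennreal (\<mu> / 2 * A) \<le> ennreal (N * 3)"
        unfolding c1 by (rule order_trans[OF order_trans[OF c2[unfolded c3 c4] c5] c6])
      then have "\<mu> / 2 * A \<le> N * 3" using N by (subst (asm) ennreal_le_iff) auto
      then have "\<mu> * A \<le> 12 * C * A" by (simp add: N_def)
      then show False using A1 by (simp add: \<mu>_def)
    qed
    then show "(\<integral>\<^sup>+ x. ?F x * indicator {- real n..real n} x \<partial>lebesgue) \<le> 1"
      using A by (simp add: J_def)
  qed measurable
  obtain b where b: "0 \<le> b" "{x. p x = \<infinity>} \<subseteq> {-b..b}"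
    using infinite_exponent_set_bounded[OF lim] .
  have [measurable]: "{-b..b} \<in> sets lebesgue" by simp
  \<comment> \<open>Exponent 1 contributes nothing, exponent \<infinity> is covered by the indicator
    of the bounded interval, and the remaining points form \<open>E\<close>.\<close>
  have "(\<integral>\<^sup>+ x \<in> - inf_set ?p'. ennreal (norm (1 / of_real \<mu> :: complex) powr enn2real (?p' x)) \<partial>lebesgue)
    \<le> (\<integral>\<^sup>+ x. ?F x + indicator {-b..b} x \<partial>lebesgue)"
  proof (rule nn_integral_mono)
    fix x
    show "ennreal (norm (1 / of_real \<mu> :: complex) powr enn2real (?p' x)) * indicator (- inf_set ?p') x
      \<le> ?F x + indicator {-b..b} x"
    proof (cases rule: conj_exp_cases[OF p, of x])
      case 1
      then show ?thesis by (simp add: inf_set_def conj_exp_eq_top)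
    next
      case 2
      then have "x \<in> {-b..b}" using b by auto
      moreover have "1 / \<mu> \<le> 1" using \<mu> by simp
      ultimately show ?thesis using 2 \<mu>
        by (simp add: inf_set_def conj_exp_eq_1 norm_divide E_def ennreal_le_1)
    next
      case 3
      have "x \<in> E" using 3 by (simp add: E_def)
      moreover have "norm (1 / of_real \<mu> :: complex) powr enn2real (?p' x) = \<mu> powr - r x"
        using \<mu> by (simp add: r_def norm_divide powr_divide powr_minus inverse_eq_divide)
      ultimately show ?thesis by (simp add: indicator_def)
    qed
  qed
  also have "\<dots> = (\<integral>\<^sup>+ x. ?F x \<partial>lebesgue) + emeasure lebesgue {-b..b}"
    by (subst nn_integral_add) auto
  also have "\<dots> \<le> 1 + ennreal (2 * b)"
    using F1 b(1) by (intro add_mono) auto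
  finally have "modular ?p' (\<lambda>x. 1 / of_real \<mu>) \<le> (1 + ennreal (2 * b)) + ennreal (norm (1 / of_real \<mu> :: complex))"
    by (intro modular_leI[OF p']) auto
  also have "\<dots> < \<infinity>" by simp
  finally show ?thesis using \<mu> by (intro Lp_spaceI[of _ \<mu>]) auto
qed

theorem theorem1p4:
  fixes p q :: "real \<Rightarrow> ennreal"
  assumes "p \<in> exponents" and "q \<in> exponents"
    and "(p \<longlongrightarrow> 1) at_infinity" and "(q \<longlongrightarrow> \<infinity>) at_infinity"
  shows "fourier_bounded p q \<longleftrightarrow> (\<lambda>x. 1) \<in> Lp_space (conj_exp p) \<inter> Lp_space q"
  using assms fourier_boundedI fourier_bounded_imp_const_in_target fourier_bounded_imp_const_in_conj
  by blast

end
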